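(* Let $A$ be a commutative Noetherian ring containing a field $K$ of characteristic zero, let $m\ge 1$, and let $R=A[X_1,\ldots,X_m]$ be standard graded over $A$. Let $I$ be a homogeneous ideal of $R$, let $i\ge 0$, and let $M:=H^i_I(R)=\bigoplus_{n\in\mathbb{Z}}M_n$. Then: (a) The following are equivalent: (i) $M_r\neq 0$ for some $r\le -m$; (ii) $M_n\neq 0$ for all $n\le -m$. (b) The following are equivalent: (i) $M_s\neq 0$ for some $s\ge 0$; (ii) $M_n\neq 0$ for all $n\ge 0$. (c) When $m\ge 2$, the following are equivalent: (i) $M_t\neq 0$ for some $t$ with $-m<t<0$; (ii) $M_n\neq 0$ for all $n\in\mathbb{Z}$.
   Context: The standard grading on $R=A[X_1,\ldots,X_m]$ is given by $\deg z=0$ for all $z\in A$ and $\deg X_j=1$ for $j=1,\ldots,m$. For a homogeneous ideal $I$, $H^i_I(R)$ is the $i$-th local cohomology module of $R$ with support in $I$, with its natural structure of $\mathbb{Z}$-graded $R$-module; $M_n$ denotes its degree $n$ component. *)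

theory Defs
  imports
    "HOL-Algebra.Algebra"
    "HOL-Library.Cardinality"
    "HOL-Library.Poly_Mapping"
    "HOL-Decision_Procs.Algebra_Aux"
begin

section \<open>Graded modules\<close>

text \<open>
  A \<open>\<int>\<close>-graded ring is given by a ring \<open>R\<close> together with the family \<open>gr\<close> of its homogeneous
  components; a graded module carries the family of its components in the field \<open>hpart\<close>.
\<close>

record ('r, 'e) gmodule = "('r, 'e) module" +
  hpart :: "int \<Rightarrow> 'e set"

definition graded_module :: "'r ring \<Rightarrow> (int \<Rightarrow> 'r set) \<Rightarrow> ('r, 'e) gmodule \<Rightarrow> bool" where
  "graded_module R gr M \<longleftrightarrow>
     module R M \<and>
     (\<forall>n. subgroup (hpart M n) (add_monoid M)) \<and>
     (\<forall>x\<in>carrier M. \<exists>!c. (\<forall>n. c n \<in> hpart M n) \<and> finite {n. c n \<noteq> \<zero>\<^bsub>M\<^esub>} \<and>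
        x = (\<Oplus>\<^bsub>M\<^esub>n\<in>{n. c n \<noteq> \<zero>\<^bsub>M\<^esub>}. c n)) \<and>
     (\<forall>a b. \<forall>r\<in>gr a. \<forall>x\<in>hpart M b. r \<odot>\<^bsub>M\<^esub> x \<in> hpart M (a + b))"

definition self_gmodule :: "'r ring \<Rightarrow> (int \<Rightarrow> 'r set) \<Rightarrow> ('r, 'r) gmodule" where
  "self_gmodule R gr =
     \<lparr>carrier = carrier R, monoid.mult = monoid.mult R, one = one R, ring.zero = ring.zero R, ring.add = ring.add R,
      module.smult = monoid.mult R, hpart = gr\<rparr>"

text \<open>Homomorphisms of graded modules are homogeneous of degree \<open>0\<close>.\<close>

definition graded_hom ::
    "'r ring \<Rightarrow> ('r, 'e) gmodule \<Rightarrow> ('r, 'f) gmodule \<Rightarrow> ('e \<Rightarrow> 'f) set" where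
  "graded_hom R M N =
     {f. f \<in> carrier M \<rightarrow> carrier N \<and>
         (\<forall>x\<in>carrier M. \<forall>y\<in>carrier M. f (x \<oplus>\<^bsub>M\<^esub> y) = f x \<oplus>\<^bsub>N\<^esub> f y) \<and>
         (\<forall>r\<in>carrier R. \<forall>x\<in>carrier M. f (r \<odot>\<^bsub>M\<^esub> x) = r \<odot>\<^bsub>N\<^esub> f x) \<and>
         (\<forall>n. f ` hpart M n \<subseteq> hpart N n)}"

definition homogeneous_ideal :: "'r ring \<Rightarrow> (int \<Rightarrow> 'r set) \<Rightarrow> 'r set \<Rightarrow> bool" where
  "homogeneous_ideal R gr I \<longleftrightarrow>
     ideal I R \<and> (\<exists>S \<subseteq> (\<Union>n. gr n). I = genideal R S)"


section \<open>Graded injective resolutions\<close>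

text \<open>
  Injective objects of the category of graded \<open>R\<close>-modules (``*injective'' modules).
  HOL cannot quantify over types inside a definition, so the test modules \<open>P\<close>, \<open>Q\<close> range over
  all graded modules whose elements lie in the type of the ring elements.  These include all
  shifts \<open>R(n)\<close> and their graded submodules, so by the graded Baer criterion the extension
  property then holds for test modules of every type.
\<close>

definition graded_injective :: "'r ring \<Rightarrow> (int \<Rightarrow> 'r set) \<Rightarrow> ('r, 'e) gmodule \<Rightarrow> bool" where
  "graded_injective R gr E \<longleftrightarrow>
     graded_module R gr E \<and>
     (\<forall>(P :: ('r, 'r) gmodule) (Q :: ('r, 'r) gmodule) u f.
        graded_module R gr P \<longrightarrow> graded_module R gr Q \<longrightarrow>
        u \<in> graded_hom R P Q \<longrightarrow> inj_on u (carrier P) \<longrightarrow> f \<in> graded_hom R P E \<longrightarrow>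
        (\<exists>h \<in> graded_hom R Q E. \<forall>x\<in>carrier P. h (u x) = f x))"

text \<open>The augmented complex \<open>0 \<rightarrow> M \<rightarrow> E 0 \<rightarrow> E 1 \<rightarrow> \<dots>\<close> with maps \<open>\<epsilon>\<close>, \<open>d 0\<close>, \<open>d 1\<close>, ... is exact.\<close>

definition graded_injective_resolution ::
    "'r ring \<Rightarrow> (int \<Rightarrow> 'r set) \<Rightarrow> ('r, 'm) gmodule \<Rightarrow>
     (nat \<Rightarrow> ('r, 'e) gmodule) \<Rightarrow> ('m \<Rightarrow> 'e) \<Rightarrow> (nat \<Rightarrow> 'e \<Rightarrow> 'e) \<Rightarrow> bool" where
  "graded_injective_resolution R gr M E \<epsilon> d \<longleftrightarrow>
     (\<forall>j. graded_injective R gr (E j)) \<and>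
     \<epsilon> \<in> graded_hom R M (E 0) \<and>
     (\<forall>j. d j \<in> graded_hom R (E j) (E (Suc j))) \<and>
     inj_on \<epsilon> (carrier M) \<and>
     a_kernel (E 0) (E 1) (d 0) = \<epsilon> ` carrier M \<and>
     (\<forall>j. a_kernel (E (Suc j)) (E (Suc (Suc j))) (d (Suc j)) = d j ` carrier (E j))"


section \<open>Local cohomology\<close>

fun ideal_power :: "'r ring \<Rightarrow> 'r set \<Rightarrow> nat \<Rightarrow> 'r set" where
  "ideal_power R I 0 = carrier R"
| "ideal_power R I (Suc k) = I \<cdot>\<^bsub>R\<^esub> ideal_power R I k"

definition torsion_part :: "'r ring \<Rightarrow> 'r set \<Rightarrow> ('r, 'e) gmodule \<Rightarrow> 'e set" where
  "torsion_part R I M =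
     {x \<in> carrier M. \<exists>k. \<forall>a\<in>ideal_power R I k. a \<odot>\<^bsub>M\<^esub> x = \<zero>\<^bsub>M\<^esub>}"

definition lc_cocycles ::
    "'r ring \<Rightarrow> 'r set \<Rightarrow> (nat \<Rightarrow> ('r, 'e) gmodule) \<Rightarrow> (nat \<Rightarrow> 'e \<Rightarrow> 'e) \<Rightarrow> nat \<Rightarrow> 'e set" where
  "lc_cocycles R I E d i = torsion_part R I (E i) \<inter> a_kernel (E i) (E (Suc i)) (d i)"

fun lc_coboundaries ::
    "'r ring \<Rightarrow> 'r set \<Rightarrow> (nat \<Rightarrow> ('r, 'e) gmodule) \<Rightarrow> (nat \<Rightarrow> 'e \<Rightarrow> 'e) \<Rightarrow> nat \<Rightarrow> 'e set" where
  "lc_coboundaries R I E d 0 = {\<zero>\<^bsub>E 0\<^esub>}"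
| "lc_coboundaries R I E d (Suc j) = d j ` torsion_part R I (E j)"

text \<open>
  \<open>H\<^sup>i\<^sub>I(M) = H\<^sup>i(\<Gamma>\<^sub>I(E))\<close>, the \<open>i\<close>-th right derived functor of the \<open>I\<close>-torsion functor \<open>\<Gamma>\<^sub>I\<close>, computed
  from a graded injective resolution \<open>E\<close> of \<open>M\<close>, with the grading induced by that of \<open>E i\<close>.
  Elements are cosets of the coboundaries.  The ring fields \<open>mult\<close> and \<open>one\<close> play no role in a module.
\<close>

definition local_cohomology ::
    "'r ring \<Rightarrow> 'r set \<Rightarrow> (nat \<Rightarrow> ('r, 'e) gmodule) \<Rightarrow> (nat \<Rightarrow> 'e \<Rightarrow> 'e) \<Rightarrow> nat \<Rightarrow>
     ('r, 'e set) gmodule" where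
  "local_cohomology R I E d i =
     (let Z = lc_cocycles R I E d i; B = lc_coboundaries R I E d i in
      \<lparr>carrier = (\<lambda>z. B +>\<^bsub>E i\<^esub> z) ` Z,
       monoid.mult = undefined,
       one = undefined,
       ring.zero = B,
       ring.add = set_add (E i),
       module.smult = (\<lambda>r C. \<Union>c\<in>C. B +>\<^bsub>E i\<^esub> (r \<odot>\<^bsub>E i\<^esub> c)),
       hpart = (\<lambda>n. (\<lambda>z. B +>\<^bsub>E i\<^esub> z) ` (Z \<inter> hpart (E i) n))\<rparr>)"


section \<open>Standard graded polynomial rings\<close>

text \<open>
  Polynomials over \<open>'a\<close> in the variables \<open>X\<^sub>j\<close>, \<open>j :: 'n\<close>: a finitely supported function from
  exponent vectors to coefficients.
\<close>

type_synonym ('a, 'n) mpoly = "('n \<Rightarrow>\<^sub>0 nat) \<Rightarrow>\<^sub>0 'a"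

definition std_part :: "int \<Rightarrow> ('a::zero, 'n::finite) mpoly set" where
  "std_part n = {p. \<forall>\<alpha>\<in>Poly_Mapping.keys p. int (\<Sum>j\<in>UNIV. Poly_Mapping.lookup \<alpha> j) = n}"

end

theory Submission
  imports Defs
begin

text \<open>
  The partial derivatives of the polynomial ring have degree \<open>-1\<close>, the derivative with respect to a
  variable sends that variable to \<open>1\<close>, and the Euler derivation, the sum over all variables \<open>X_k\<close> of
  \<open>X_k\<close> times the derivative \<open>D_k\<close>, multiplies each polynomial of degree \<open>a\<close> by \<open>a\<close>. The proof
  transports this structure to the local cohomology module \<open>M\<close>, directly on the given graded
  injective resolution.

  Every derivation of the ring lifts to a chain map on the resolution that satisfies the Leibniz rule
  (\<open>lift_exists\<close>), and two lifts of a derivation of degree \<open>0\<close> differ by a linear chain map that is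
  null-homotopic (\<open>null_homotopic\<close>). A lift preserves torsion, because a derivation maps each power of
  \<open>I\<close> into the preceding one (\<open>torsion_lift\<close>). So derivations act on \<open>M\<close>, and in degree \<open>0\<close>
  the action depends on the derivation only. Now the Euler derivation has two lifts: the sum of the \<open>X_k \<delta>_k\<close>, where \<open>\<delta>_k\<close> lifts
  \<open>D_k\<close>, and the operator that multiplies elements of degree \<open>n\<close> by \<open>n\<close>. Therefore
  the sum of the \<open>X_k \<delta>_k\<close> acts on \<open>M_n\<close> as \<open>n\<close> (\<open>euler_cohomology\<close>), and by the Leibniz rule the sum of
  the \<open>\<delta>_k X_k\<close> acts on \<open>M_n\<close> as \<open>n + m\<close>.

  Nonzero integers are units in the ring. Hence a class in \<open>M_n\<close> that is killed by all \<open>X_k\<close> vanishes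
  if \<open>n \<noteq> -m\<close>, and a class that is killed by all \<open>\<delta>_k\<close> vanishes if \<open>n \<noteq> 0\<close>. So from
  \<open>M_n \<noteq> 0\<close> follows \<open>M_{n+1} \<noteq> 0\<close> unless \<open>n = -m\<close>, and \<open>M_{n-1} \<noteq> 0\<close> unless \<open>n = 0\<close>
  (\<open>degree_steps\<close>). Going up is blocked only at \<open>-m\<close> and going down only at \<open>0\<close>, which is what the three
  equivalences say.

  Lifts and homotopies both come from one extension theorem (\<open>twisted_hom_extension\<close>). It is Baer's
  criterion, with Zorn's lemma, for maps that satisfy a Leibniz rule instead of linearity.
\<close>

section \<open>Components in graded rings and modules\<close>

text \<open>
  The family of components singled out by the uniqueness clause of a graded module; outside the
  carrier its value is arbitrary.
\<close>

definition component :: "('r, 'e) gmodule \<Rightarrow> 'e \<Rightarrow> int \<Rightarrow> 'e" where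
  "component N x = (THE c. (\<forall>n. c n \<in> hpart N n) \<and> finite {n. c n \<noteq> \<zero>\<^bsub>N\<^esub>} \<and>
        x = (\<Oplus>\<^bsub>N\<^esub>n\<in>{n. c n \<noteq> \<zero>\<^bsub>N\<^esub>}. c n))"

text \<open>
  A graded commutative ring whose carrier is a whole type. The projections \<open>cmp\<close> onto the
  homogeneous components are a parameter, because for concrete rings they have an explicit formula.
\<close>

locale graded_comm_ring =
  fixes gr :: "int \<Rightarrow> 'r::comm_ring_1 set" and cmp :: "'r \<Rightarrow> int \<Rightarrow> 'r"
  assumes one_gr: "1 \<in> gr 0"
    and zero_gr: "0 \<in> gr a"
    and add_gr: "r \<in> gr a \<Longrightarrow> s \<in> gr a \<Longrightarrow> r + s \<in> gr a"
    and uminus_gr: "r \<in> gr a \<Longrightarrow> - r \<in> gr a"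
    and mult_gr: "r \<in> gr a \<Longrightarrow> s \<in> gr b \<Longrightarrow> r * s \<in> gr (a + b)"
    and cmp_gr: "cmp r a \<in> gr a"
    and cmp_add: "cmp (r + s) a = cmp r a + cmp s a"
    and cmp_homogeneous: "r \<in> gr a \<Longrightarrow> cmp r b = (if b = a then r else 0)"
    and finite_cmp: "finite {a. cmp r a \<noteq> 0}"
    and sum_cmp: "(\<Sum>a | cmp r a \<noteq> 0. cmp r a) = r"
begin

lemma cmp_zero: "cmp 0 a = 0"
  using cmp_homogeneous[OF zero_gr] by simp

lemma of_int_gr: "of_int k \<in> gr 0"
proof -
  have nat: "of_nat n \<in> gr 0" for n
    by (induction n) (auto intro: zero_gr one_gr add_gr)
  show ?thesis
    by (cases k rule: int_cases2) (auto intro: nat uminus_gr)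
qed

text \<open>
  Formulas that mix a derivation with the grading are additive in the ring element, so it suffices to
  check them in each degree, where the action of the grading is explicit.
\<close>

lemma homogeneous_ring_induct:
  assumes hom: "\<And>a r. r \<in> gr a \<Longrightarrow> P r"
    and add: "\<And>r s. P r \<Longrightarrow> P s \<Longrightarrow> P (r + s)"
  shows "P r"
proof -
  have "P (\<Sum>a\<in>F. cmp r a)" if "finite F" for F
    using that by induction (auto intro: hom[OF zero_gr] hom[OF cmp_gr] add)
  from this[OF finite_cmp[of r]] show ?thesis by (simp add: sum_cmp)
qed

lemma cmp_sum: "finite F \<Longrightarrow> cmp (\<Sum>i\<in>F. f i) a = (\<Sum>i\<in>F. cmp (f i) a)"
  by (induction F rule: finite_induct) (auto simp: cmp_zero cmp_add)

text \<open>
  The graded submodule \<open>J\<close> of the free module whose generator \<open>1\<close> sits in degree \<open>s\<close>. These are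
  the test modules of the graded version of Baer's criterion, and their elements are ring elements,
  as the definition of a graded injective module demands.
\<close>

definition shifted_ideal :: "'r set \<Rightarrow> int \<Rightarrow> ('r, 'r) gmodule" where
  "shifted_ideal J s = \<lparr>carrier = J, monoid.mult = (*), one = 1, ring.zero = 0, ring.add = (+),
      module.smult = (*), hpart = (\<lambda>k. gr (k - s) \<inter> J)\<rparr>"

lemma shifted_ideal_simps [simp]:
  "carrier (shifted_ideal J s) = J" "ring.zero (shifted_ideal J s) = 0"
  "ring.add (shifted_ideal J s) = (+)" "module.smult (shifted_ideal J s) = (*)"
  "hpart (shifted_ideal J s) k = gr (k - s) \<inter> J"
  by (simp_all add: shifted_ideal_def)

lemma graded_module_shifted_ideal:
  assumes zero: "0 \<in> J" and add: "\<And>r s. r \<in> J \<Longrightarrow> s \<in> J \<Longrightarrow> r + s \<in> J"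
    and mult: "\<And>r s. s \<in> J \<Longrightarrow> r * s \<in> J" and cmp: "\<And>r a. r \<in> J \<Longrightarrow> cmp r a \<in> J"
  shows "graded_module cring_class_ops gr (shifted_ideal J s)"
proof -
  let ?N = "shifted_ideal J s"
  have uminus: "- r \<in> J" if "r \<in> J" for r using mult[OF that, of "-1"] by simp
  have ag: "abelian_group ?N"
    by (rule abelian_groupI) (auto simp: zero add uminus add.assoc add.commute intro!: bexI[of _ "- x" for x])
  interpret N: abelian_group ?N by (rule ag)
  have fs: "finsum ?N f F = sum f F" if "finite F" "f \<in> F \<rightarrow> J" for F :: "int set" and f
    using that
  proof (induction F rule: finite_induct)
    case (insert x F)
    then show ?case by (subst N.finsum_insert) auto
  qed auto
  have md: "module cring_class_ops ?N"
    by (rule moduleI) (auto simp: cring_class ag class_simps mult algebra_simps)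
  have sub: "subgroup (hpart ?N n) (add_monoid ?N)" for n
  proof (rule N.add.subgroupI)
    show "hpart ?N n \<subseteq> carrier ?N" by auto
    show "hpart ?N n \<noteq> {}" using zero zero_gr by auto
  next
    fix x assume x: "x \<in> hpart ?N n"
    have "\<ominus>\<^bsub>?N\<^esub> x = - x"
      by (rule N.minus_equality) (use x uminus in auto)
    then show "\<ominus>\<^bsub>?N\<^esub> x \<in> hpart ?N n" using x uminus_gr uminus by auto
  qed (auto simp: add add_gr)
  have dec: "\<exists>!c. (\<forall>n. c n \<in> hpart ?N n) \<and> finite {n. c n \<noteq> \<zero>\<^bsub>?N\<^esub>} \<and>
        x = (\<Oplus>\<^bsub>?N\<^esub>n\<in>{n. c n \<noteq> \<zero>\<^bsub>?N\<^esub>}. c n)" if x: "x \<in> carrier ?N" for x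
  proof (rule ex1I)
    let ?c = "\<lambda>n. cmp x (n - s)"
    have im: "{n. ?c n \<noteq> 0} = (\<lambda>a. a + s) ` {a. cmp x a \<noteq> 0}"
      by (force simp: image_iff intro: exI[of _ "n - s" for n])
    have fin: "finite {n. ?c n \<noteq> 0}" unfolding im by (intro finite_imageI finite_cmp)
    have "(\<Sum>n | ?c n \<noteq> 0. ?c n) = (\<Sum>a | cmp x a \<noteq> 0. cmp x a)"
      unfolding im by (subst sum.reindex) (auto simp: inj_on_def)
    then show "(\<forall>n. ?c n \<in> hpart ?N n) \<and> finite {n. ?c n \<noteq> \<zero>\<^bsub>?N\<^esub>} \<and>
        x = (\<Oplus>\<^bsub>?N\<^esub>n\<in>{n. ?c n \<noteq> \<zero>\<^bsub>?N\<^esub>}. ?c n)"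
      using x fin cmp by (simp add: fs sum_cmp cmp_gr)
  next
    fix c assume c: "(\<forall>n. c n \<in> hpart ?N n) \<and> finite {n. c n \<noteq> \<zero>\<^bsub>?N\<^esub>} \<and>
        x = (\<Oplus>\<^bsub>?N\<^esub>n\<in>{n. c n \<noteq> \<zero>\<^bsub>?N\<^esub>}. c n)"
    then have x: "x = (\<Sum>n | c n \<noteq> 0. c n)" and cn: "\<And>n. c n \<in> gr (n - s)"
      and fin: "finite {n. c n \<noteq> 0}" by (auto simp: fs)
    show "c = (\<lambda>n. cmp x (n - s))"
    proof
      fix n
      have "cmp x (n - s) = (\<Sum>k | c k \<noteq> 0. if n = k then c k else 0)"
        unfolding x by (simp add: cmp_sum[OF fin] cmp_homogeneous[OF cn] cong: sum.cong)
      also have "\<dots> = c n" using fin by (simp add: sum.delta)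
      finally show "c n = cmp x (n - s)" ..
    qed
  qed
  show ?thesis
    unfolding graded_module_def using md sub dec mult mult_gr
    by auto (metis add_diff_eq)
qed

lemma self_gmodule_eq: "self_gmodule cring_class_ops gr = shifted_ideal UNIV 0"
  by (simp add: self_gmodule_def shifted_ideal_def cring_class_ops_def)

end

locale graded_mod = graded_comm_ring gr cmp
  for gr :: "int \<Rightarrow> 'r::comm_ring_1 set" and cmp :: "'r \<Rightarrow> int \<Rightarrow> 'r" +
  fixes N :: "('r, 'e) gmodule" (structure)
  assumes graded: "graded_module cring_class_ops gr N"
begin

sublocale module cring_class_ops N
  using graded by (simp add: graded_module_def)

lemma smult_mem: "x \<in> carrier N \<Longrightarrow> r \<odot> x \<in> carrier N"
  by (simp add: carrier_class)

lemma smult_add_left: "x \<in> carrier N \<Longrightarrow> (r + s) \<odot> x = r \<odot> x \<oplus> s \<odot> x"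
  using smult_l_distr[of r s x] by (simp add: class_simps)

lemma smult_add_right: "x \<in> carrier N \<Longrightarrow> y \<in> carrier N \<Longrightarrow> r \<odot> (x \<oplus> y) = r \<odot> x \<oplus> r \<odot> y"
  using smult_r_distr[of r x y] by (simp add: class_simps)

lemma smult_mult: "x \<in> carrier N \<Longrightarrow> (r * s) \<odot> x = r \<odot> (s \<odot> x)"
  using smult_assoc1[of r s x] by (simp add: class_simps)

lemma smult_1: "x \<in> carrier N \<Longrightarrow> 1 \<odot> x = x"
  using smult_one[of x] by (simp add: class_simps)

lemma smult_0: "x \<in> carrier N \<Longrightarrow> 0 \<odot> x = \<zero>"
  using smult_l_null[of x] by (simp add: class_simps)

lemma smult_zero: "r \<odot> \<zero> = \<zero>"
  using smult_r_null[of r] by (simp add: class_simps)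

lemma add_uminus: "x \<in> carrier N \<Longrightarrow> x \<oplus> (-1) \<odot> x = \<zero>"
  using smult_add_left[of x 1 "-1"] by (simp add: smult_1 smult_0)

lemma smult_m1: "x \<in> carrier N \<Longrightarrow> (-1) \<odot> x = \<ominus> x"
  using minus_equality[of "(-1) \<odot> x" x] by (simp add: add_uminus smult_mem a_comm)

lemma eq_iff_diff:
  "x \<in> carrier N \<Longrightarrow> y \<in> carrier N \<Longrightarrow> x \<oplus> (-1) \<odot> y = \<zero> \<longleftrightarrow> x = y"
  by (metis a_assoc add_uminus l_zero r_zero smult_mem a_comm)

lemma hpart_subgroup: "subgroup (hpart N n) (add_monoid N)"
  using graded by (simp add: graded_module_def)

lemma hpart_carrier: "x \<in> hpart N n \<Longrightarrow> x \<in> carrier N"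
  using subgroup.subset[OF hpart_subgroup] by auto

lemma hpart_zero: "\<zero> \<in> hpart N n"
  using subgroup.one_closed[OF hpart_subgroup] by simp

lemma hpart_add: "x \<in> hpart N n \<Longrightarrow> y \<in> hpart N n \<Longrightarrow> x \<oplus> y \<in> hpart N n"
  using subgroup.m_closed[OF hpart_subgroup] by simp

lemma hpart_smult: "r \<in> gr a \<Longrightarrow> x \<in> hpart N b \<Longrightarrow> r \<odot> x \<in> hpart N (a + b)"
  using graded by (simp add: graded_module_def)

lemma component_props:
  assumes "x \<in> carrier N"
  shows component_hpart: "component N x n \<in> hpart N n"
    and finite_component: "finite {n. component N x n \<noteq> \<zero>}"
    and finsum_component: "x = (\<Oplus>n\<in>{n. component N x n \<noteq> \<zero>}. component N x n)"
proof -
  have "\<exists>!c. (\<forall>n. c n \<in> hpart N n) \<and> finite {n. c n \<noteq> \<zero>} \<and> x = (\<Oplus>n\<in>{n. c n \<noteq> \<zero>}. c n)"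
    using graded assms by (simp add: graded_module_def)
  from theI'[OF this, folded component_def]
  show "component N x n \<in> hpart N n" "finite {n. component N x n \<noteq> \<zero>}"
    "x = (\<Oplus>n\<in>{n. component N x n \<noteq> \<zero>}. component N x n)"
    by blast+
qed

lemma component_carrier: "x \<in> carrier N \<Longrightarrow> component N x n \<in> carrier N"
  by (blast intro: component_hpart hpart_carrier)

lemma finsum_enlarge:
  assumes "finite F" "{n. c n \<noteq> \<zero>} \<subseteq> F" "\<And>n::int. c n \<in> carrier N"
  shows "(\<Oplus>n\<in>{n. c n \<noteq> \<zero>}. c n) = (\<Oplus>n\<in>F. c n)"
  using assms by (intro add.finprod_mono_neutral_cong_left) auto

text \<open>
  The uniqueness clause of a graded module speaks of the exact support of a family. Allowing any
  finite index set that contains the support makes it usable for computing components.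
\<close>

lemma component_unique:
  assumes "finite F" "\<And>n. c n \<in> hpart N n" "\<And>n. n \<notin> F \<Longrightarrow> c n = \<zero>"
  shows "component N (\<Oplus>n\<in>F. c n) = c"
proof -
  let ?x = "\<Oplus>n\<in>F. c n"
  have x: "?x \<in> carrier N" using assms(2) hpart_carrier by (intro finsum_closed) auto
  have ex: "\<exists>!c. (\<forall>n. c n \<in> hpart N n) \<and> finite {n. c n \<noteq> \<zero>} \<and> ?x = (\<Oplus>n\<in>{n. c n \<noteq> \<zero>}. c n)"
    using graded x by (simp add: graded_module_def)
  have sub: "{n. c n \<noteq> \<zero>} \<subseteq> F" using assms(3) by auto
  have "?x = (\<Oplus>n\<in>{n. c n \<noteq> \<zero>}. c n)"
    using finsum_enlarge[OF assms(1) sub] assms(2) hpart_carrier by metis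
  then show ?thesis unfolding component_def
    using assms sub by (intro the1_equality[OF ex]) (auto intro: finite_subset)
qed

lemma component_homogeneous:
  assumes "x \<in> hpart N k"
  shows "component N x n = (if n = k then x else \<zero>)"
proof -
  let ?c = "\<lambda>n. if n = k then x else \<zero>"
  have "(\<Oplus>n\<in>{k}. ?c n) = x"
    using assms hpart_carrier by (subst finsum_insert) auto
  moreover have "component N (\<Oplus>n\<in>{k}. ?c n) = ?c"
    using assms by (intro component_unique) (auto intro: hpart_zero)
  ultimately have "component N x = ?c" by metis
  then show ?thesis by simp
qed

lemma component_add:
  assumes x: "x \<in> carrier N" and y: "y \<in> carrier N"
  shows "component N (x \<oplus> y) n = component N x n \<oplus> component N y n"
proof -
  define F where "F = {n. component N x n \<noteq> \<zero>} \<union> {n. component N y n \<noteq> \<zero>}"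
  have F: "finite F" using x y by (simp add: F_def finite_component)
  have c: "component N x n \<in> carrier N" "component N y n \<in> carrier N" for n
    using x y component_carrier by auto
  have "(\<Oplus>n\<in>F. component N x n \<oplus> component N y n) = (\<Oplus>n\<in>F. component N x n) \<oplus> (\<Oplus>n\<in>F. component N y n)"
    using c by (intro finsum_addf) auto
  also have "(\<Oplus>n\<in>F. component N x n) = x"
    using finsum_component[OF x] finsum_enlarge[OF F, of "component N x"] c by (auto simp: F_def)
  also have "(\<Oplus>n\<in>F. component N y n) = y"
    using finsum_component[OF y] finsum_enlarge[OF F, of "component N y"] c by (auto simp: F_def)
  finally have "x \<oplus> y = (\<Oplus>n\<in>F. component N x n \<oplus> component N y n)" ..
  moreover have "component N (\<Oplus>n\<in>F. component N x n \<oplus> component N y n)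
      = (\<lambda>n. component N x n \<oplus> component N y n)"
    by (intro component_unique F hpart_add component_hpart x y) (auto simp: F_def)
  ultimately show ?thesis by simp
qed

lemma component_eqI:
  assumes "x \<in> carrier N" "y \<in> carrier N" "\<And>n. component N x n = component N y n"
  shows "x = y"
  using finsum_component[OF assms(1)] finsum_component[OF assms(2)] assms(3) by simp

text \<open>
  The module counterpart of \<open>homogeneous_ring_induct\<close>.
\<close>

lemma homogeneous_induct [consumes 1, case_names homogeneous add]:
  assumes x: "x \<in> carrier N"
    and hom: "\<And>k x. x \<in> hpart N k \<Longrightarrow> P x"
    and add: "\<And>x y. x \<in> carrier N \<Longrightarrow> y \<in> carrier N \<Longrightarrow> P x \<Longrightarrow> P y \<Longrightarrow> P (x \<oplus> y)"
  shows "P x"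
proof -
  have "(\<Oplus>n\<in>F. component N x n) \<in> carrier N \<and> P (\<Oplus>n\<in>F. component N x n)" if "finite F" for F
    using that
  proof (induction F rule: finite_induct)
    case empty
    then show ?case using hom[OF hpart_zero] by simp
  next
    case (insert k F)
    then show ?case
      using x by (subst (1 2) finsum_insert)
        (auto intro!: add hom[OF component_hpart] component_carrier)
  qed
  from this[OF finite_component[OF x]] show ?thesis
    using finsum_component[OF x] by simp
qed

lemma component_smult_on_homogeneous:
  assumes x: "x \<in> hpart N k"
  shows "component N (r \<odot> x) n = cmp r (n - k) \<odot> x"
proof (induction r rule: homogeneous_ring_induct)
  case (1 a r)
  then show ?case
    using component_homogeneous[OF hpart_smult[OF 1 x]] hpart_carrier[OF x]
    by (auto simp: cmp_homogeneous smult_0)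
next
  case (2 r s)
  then show ?case using hpart_carrier[OF x] by (simp add: smult_add_left component_add cmp_add smult_mem)
qed

end

section \<open>Maps that satisfy a Leibniz rule\<close>

context graded_comm_ring
begin

definition derivation :: "int \<Rightarrow> ('r \<Rightarrow> 'r) \<Rightarrow> bool" where
  "derivation e D \<longleftrightarrow>
     (\<forall>r s. D (r + s) = D r + D s) \<and> (\<forall>r s. D (r * s) = r * D s + s * D r) \<and>
     (\<forall>a. \<forall>r\<in>gr a. D r \<in> gr (a + e))"

lemma
  assumes "derivation e D"
  shows derivation_add: "D (r + s) = D r + D s"
    and derivation_mult: "D (r * s) = r * D s + s * D r"
    and derivation_gr: "r \<in> gr a \<Longrightarrow> D r \<in> gr (a + e)"
  using assms by (auto simp: derivation_def)

lemma derivation_zero: "derivation e D \<Longrightarrow> D 0 = 0"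
  using derivation_add[of e D 0 0] by simp

lemma derivation_minus_one:
  assumes "derivation e D" shows "D (-1) = 0"
proof -
  have "D 1 = 0" using derivation_mult[OF assms, of 1 1] by simp
  then show ?thesis using derivation_add[OF assms, of 1 "-1"] derivation_zero[OF assms] by simp
qed

lemma derivation_cmp:
  assumes "derivation e D" shows "cmp (D r) (a + e) = D (cmp r a)"
proof (induction r rule: homogeneous_ring_induct)
  case (1 b r)
  then show ?case
    using cmp_homogeneous[OF derivation_gr[OF assms 1]]
    by (auto simp: cmp_homogeneous derivation_zero[OF assms])
next
  case (2 r s)
  then show ?case by (simp add: derivation_add[OF assms] cmp_add)
qed

lemma derivation_null: "derivation e (\<lambda>_. 0)"
  by (auto simp: derivation_def zero_gr)

text \<open>
  Additive maps of degree \<open>e\<close> that satisfy the Leibniz rule \<open>f (r x) = r f x + D r g x\<close>. Two kinds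
  matter: \<open>D = 0\<close> gives the linear maps, and \<open>g = id\<close> gives the maps over a derivation \<open>D\<close>, that is,
  the actions of \<open>D\<close> on a module. Keeping a general \<open>g\<close> lets one extension
  theorem serve both.
\<close>

definition twisted_hom ::
    "int \<Rightarrow> ('r \<Rightarrow> 'r) \<Rightarrow> ('q \<Rightarrow> 'e) \<Rightarrow> ('r, 'q) gmodule \<Rightarrow> ('r, 'e) gmodule \<Rightarrow> ('q \<Rightarrow> 'e) \<Rightarrow> bool" where
  "twisted_hom e D g Q E f \<longleftrightarrow>
     f \<in> carrier Q \<rightarrow> carrier E \<and>
     (\<forall>x\<in>carrier Q. \<forall>y\<in>carrier Q. f (x \<oplus>\<^bsub>Q\<^esub> y) = f x \<oplus>\<^bsub>E\<^esub> f y) \<and>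
     (\<forall>r. \<forall>x\<in>carrier Q. f (r \<odot>\<^bsub>Q\<^esub> x) = r \<odot>\<^bsub>E\<^esub> f x \<oplus>\<^bsub>E\<^esub> D r \<odot>\<^bsub>E\<^esub> g x) \<and>
     (\<forall>n. \<forall>x\<in>hpart Q n. f x \<in> hpart E (n + e))"

abbreviation linear_hom :: "('r, 'q) gmodule \<Rightarrow> ('r, 'e) gmodule \<Rightarrow> ('q \<Rightarrow> 'e) \<Rightarrow> bool" where
  "linear_hom Q E f \<equiv> twisted_hom 0 (\<lambda>_. 0) (\<lambda>_. \<zero>\<^bsub>E\<^esub>) Q E f"

lemma
  assumes "twisted_hom e D g Q E f"
  shows twisted_hom_closed: "x \<in> carrier Q \<Longrightarrow> f x \<in> carrier E"
    and twisted_hom_add: "x \<in> carrier Q \<Longrightarrow> y \<in> carrier Q \<Longrightarrow> f (x \<oplus>\<^bsub>Q\<^esub> y) = f x \<oplus>\<^bsub>E\<^esub> f y"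
    and twisted_hom_smult:
      "x \<in> carrier Q \<Longrightarrow> f (r \<odot>\<^bsub>Q\<^esub> x) = r \<odot>\<^bsub>E\<^esub> f x \<oplus>\<^bsub>E\<^esub> D r \<odot>\<^bsub>E\<^esub> g x"
    and twisted_hom_hpart: "x \<in> hpart Q n \<Longrightarrow> f x \<in> hpart E (n + e)"
  using assms by (auto simp: twisted_hom_def)

lemma twisted_hom_zero:
  assumes "graded_mod gr cmp Q" "graded_mod gr cmp E" "twisted_hom e D g Q E f"
  shows "f \<zero>\<^bsub>Q\<^esub> = \<zero>\<^bsub>E\<^esub>"
proof -
  interpret Q: graded_mod gr cmp Q by fact
  interpret E: graded_mod gr cmp E by fact
  have "f \<zero>\<^bsub>Q\<^esub> = f \<zero>\<^bsub>Q\<^esub> \<oplus>\<^bsub>E\<^esub> f \<zero>\<^bsub>Q\<^esub>"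
    using twisted_hom_add[OF assms(3), of "\<zero>\<^bsub>Q\<^esub>" "\<zero>\<^bsub>Q\<^esub>"] by simp
  then show ?thesis
    using twisted_hom_closed[OF assms(3), of "\<zero>\<^bsub>Q\<^esub>"] by (simp add: E.add.l_cancel_one)
qed

lemma twisted_hom_component:
  assumes Q: "graded_mod gr cmp Q" and E: "graded_mod gr cmp E" and f: "twisted_hom e D g Q E f"
    and x: "x \<in> carrier Q"
  shows "component E (f x) (n + e) = f (component Q x n)"
proof -
  interpret Q: graded_mod gr cmp Q by fact
  interpret E: graded_mod gr cmp E by fact
  show ?thesis using x
  proof (induction rule: Q.homogeneous_induct)
    case (homogeneous k x)
    then show ?case
      using E.component_homogeneous[OF twisted_hom_hpart[OF f homogeneous]]
      by (auto simp: Q.component_homogeneous twisted_hom_zero[OF Q E f])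
  next
    case (add x y)
    then show ?case
      by (simp add: twisted_hom_add[OF f] twisted_hom_closed[OF f] Q.component_add E.component_add
          Q.component_carrier)
  qed
qed

lemma linear_hom_smult:
  assumes "graded_mod gr cmp E" "linear_hom Q E f" "x \<in> carrier Q"
  shows "f (r \<odot>\<^bsub>Q\<^esub> x) = r \<odot>\<^bsub>E\<^esub> f x"
proof -
  interpret E: graded_mod gr cmp E by fact
  show ?thesis
    using twisted_hom_smult[OF assms(2,3), of r] twisted_hom_closed[OF assms(2,3)]
    by (simp add: E.smult_zero E.smult_mem)
qed

lemma linear_hom_iff:
  assumes "graded_mod gr cmp E"
  shows "linear_hom Q E f \<longleftrightarrow> f \<in> graded_hom cring_class_ops Q E"
proof -
  interpret E: graded_mod gr cmp E by fact
  have "r \<odot>\<^bsub>E\<^esub> y \<oplus>\<^bsub>E\<^esub> 0 \<odot>\<^bsub>E\<^esub> \<zero>\<^bsub>E\<^esub> = r \<odot>\<^bsub>E\<^esub> y" if "y \<in> carrier E" for r y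
    using that by (simp add: E.smult_zero E.smult_mem)
  then show ?thesis
    by (auto simp: twisted_hom_def graded_hom_def carrier_class Pi_iff image_subset_iff)
qed

text \<open>
  One half of Baer's criterion, in the form in which it is used: a linear map from a homogeneous
  ideal into a graded injective module is multiplication by an element, namely the value at \<open>1\<close> of
  an extension to the whole ring.
\<close>

lemma graded_injective_test:
  assumes inj: "graded_injective cring_class_ops gr E"
    and zero: "0 \<in> J" and add: "\<And>r s. r \<in> J \<Longrightarrow> s \<in> J \<Longrightarrow> r + s \<in> J"
    and mult: "\<And>r s. s \<in> J \<Longrightarrow> r * s \<in> J" and cmp: "\<And>r a. r \<in> J \<Longrightarrow> cmp r a \<in> J"
    and \<phi>_closed: "\<And>r. r \<in> J \<Longrightarrow> \<phi> r \<in> carrier E"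
    and \<phi>_add: "\<And>r s. r \<in> J \<Longrightarrow> s \<in> J \<Longrightarrow> \<phi> (r + s) = \<phi> r \<oplus>\<^bsub>E\<^esub> \<phi> s"
    and \<phi>_mult: "\<And>r s. s \<in> J \<Longrightarrow> \<phi> (r * s) = r \<odot>\<^bsub>E\<^esub> \<phi> s"
    and \<phi>_gr: "\<And>r a. r \<in> J \<Longrightarrow> r \<in> gr a \<Longrightarrow> \<phi> r \<in> hpart E (a + n)"
  obtains y where "y \<in> hpart E n" "\<And>r. r \<in> J \<Longrightarrow> \<phi> r = r \<odot>\<^bsub>E\<^esub> y"
proof -
  let ?P = "shifted_ideal J n" and ?Q = "shifted_ideal UNIV n"
  have P: "graded_module cring_class_ops gr ?P" and Q: "graded_module cring_class_ops gr ?Q"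
    by (auto intro!: graded_module_shifted_ideal zero add mult cmp)
  have "\<phi> \<in> graded_hom cring_class_ops ?P E"
    using \<phi>_closed \<phi>_add \<phi>_mult \<phi>_gr[of _ "k - n" for k] by (auto simp: graded_hom_def)
  moreover have "id \<in> graded_hom cring_class_ops ?P ?Q" by (auto simp: graded_hom_def)
  ultimately obtain h where h: "h \<in> graded_hom cring_class_ops ?Q E" "\<And>r. r \<in> J \<Longrightarrow> h r = \<phi> r"
    using inj P Q unfolding graded_injective_def by (metis inj_on_id id_apply shifted_ideal_simps(1))
  show thesis
  proof
    show "h 1 \<in> hpart E n" using h(1) one_gr by (auto simp: graded_hom_def dest!: spec[of _ n])
    show "\<phi> r = r \<odot>\<^bsub>E\<^esub> h 1" if "r \<in> J" for r
    proof -
      have "h (r * s) = r \<odot>\<^bsub>E\<^esub> h s" for s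
        using h(1) by (auto simp: graded_hom_def carrier_class)
      from this[of 1] show ?thesis using h(2)[OF that] by simp
    qed
  qed
qed

section \<open>Baer extension of maps with a Leibniz rule\<close>

text \<open>
  The graph of a map that satisfies the Leibniz rule and is defined on a graded submodule of \<open>Q\<close>.
  Working with graphs turns "extends" into inclusion, as Zorn's lemma wants. The last clause says that
  the relation is single-valued, and closure under components says that the domain is graded
  and the map homogeneous of degree \<open>e\<close>.
\<close>

definition twisted_graph ::
    "int \<Rightarrow> ('r \<Rightarrow> 'r) \<Rightarrow> ('q \<Rightarrow> 'e) \<Rightarrow> ('r, 'q) gmodule \<Rightarrow> ('r, 'e) gmodule \<Rightarrow> ('q \<times> 'e) set \<Rightarrow> bool" where
  "twisted_graph e D g Q E G \<longleftrightarrow>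
     G \<subseteq> carrier Q \<times> carrier E \<and> (\<zero>\<^bsub>Q\<^esub>, \<zero>\<^bsub>E\<^esub>) \<in> G \<and>
     (\<forall>x y x' y'. (x, y) \<in> G \<longrightarrow> (x', y') \<in> G \<longrightarrow> (x \<oplus>\<^bsub>Q\<^esub> x', y \<oplus>\<^bsub>E\<^esub> y') \<in> G) \<and>
     (\<forall>r x y. (x, y) \<in> G \<longrightarrow> (r \<odot>\<^bsub>Q\<^esub> x, r \<odot>\<^bsub>E\<^esub> y \<oplus>\<^bsub>E\<^esub> D r \<odot>\<^bsub>E\<^esub> g x) \<in> G) \<and>
     (\<forall>n x y. (x, y) \<in> G \<longrightarrow> (component Q x n, component E y (n + e)) \<in> G) \<and>
     (\<forall>y. (\<zero>\<^bsub>Q\<^esub>, y) \<in> G \<longrightarrow> y = \<zero>\<^bsub>E\<^esub>)"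

lemma
  assumes "twisted_graph e D g Q E G"
  shows twisted_graph_closed: "(x, y) \<in> G \<Longrightarrow> x \<in> carrier Q \<and> y \<in> carrier E"
    and twisted_graph_zero: "(\<zero>\<^bsub>Q\<^esub>, \<zero>\<^bsub>E\<^esub>) \<in> G"
    and twisted_graph_add:
      "(x, y) \<in> G \<Longrightarrow> (x', y') \<in> G \<Longrightarrow> (x \<oplus>\<^bsub>Q\<^esub> x', y \<oplus>\<^bsub>E\<^esub> y') \<in> G"
    and twisted_graph_smult:
      "(x, y) \<in> G \<Longrightarrow> (r \<odot>\<^bsub>Q\<^esub> x, r \<odot>\<^bsub>E\<^esub> y \<oplus>\<^bsub>E\<^esub> D r \<odot>\<^bsub>E\<^esub> g x) \<in> G"
    and twisted_graph_component: "(x, y) \<in> G \<Longrightarrow> (component Q x n, component E y (n + e)) \<in> G"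
    and twisted_graph_zeroD: "(\<zero>\<^bsub>Q\<^esub>, y) \<in> G \<Longrightarrow> y = \<zero>\<^bsub>E\<^esub>"
  using assms unfolding twisted_graph_def by (blast, blast, blast, blast, blast, blast)

lemma twisted_graph_Union:
  assumes ne: "\<C> \<noteq> {}" and chain: "subset.chain {G. twisted_graph e D g Q E G} \<C>"
  shows "twisted_graph e D g Q E (\<Union>\<C>)"
proof -
  have tw: "twisted_graph e D g Q E G" if "G \<in> \<C>" for G
    using chain that unfolding subset.chain_def by blast
  have tot: "G \<subseteq> G' \<or> G' \<subseteq> G" if "G \<in> \<C>" "G' \<in> \<C>" for G G'
    using chain that unfolding subset_chain_def by blast
  show ?thesis
    unfolding twisted_graph_def
  proof (intro conjI allI impI)
    show "\<Union>\<C> \<subseteq> carrier Q \<times> carrier E"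
      using twisted_graph_closed[OF tw] by fast
    show "(\<zero>\<^bsub>Q\<^esub>, \<zero>\<^bsub>E\<^esub>) \<in> \<Union>\<C>"
      using ne twisted_graph_zero[OF tw] by fast
  next
    fix x y x' y' assume "(x, y) \<in> \<Union>\<C>" "(x', y') \<in> \<Union>\<C>"
    then obtain G G' where *: "(x, y) \<in> G" "G \<in> \<C>" "(x', y') \<in> G'" "G' \<in> \<C>" by blast
    show "(x \<oplus>\<^bsub>Q\<^esub> x', y \<oplus>\<^bsub>E\<^esub> y') \<in> \<Union>\<C>"
      using tot[OF *(2,4)] * twisted_graph_add[OF tw[OF *(2)]] twisted_graph_add[OF tw[OF *(4)]]
      by blast
  next
    fix r x y assume "(x, y) \<in> \<Union>\<C>"
    then obtain G where *: "(x, y) \<in> G" "G \<in> \<C>" by blast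
    show "(r \<odot>\<^bsub>Q\<^esub> x, r \<odot>\<^bsub>E\<^esub> y \<oplus>\<^bsub>E\<^esub> D r \<odot>\<^bsub>E\<^esub> g x) \<in> \<Union>\<C>"
      using twisted_graph_smult[OF tw *(1)] * by blast
  next
    fix n x y assume "(x, y) \<in> \<Union>\<C>"
    then obtain G where *: "(x, y) \<in> G" "G \<in> \<C>" by blast
    show "(component Q x n, component E y (n + e)) \<in> \<Union>\<C>"
      using twisted_graph_component[OF tw *(1)] * by blast
  next
    fix y assume "(\<zero>\<^bsub>Q\<^esub>, y) \<in> \<Union>\<C>"
    then obtain G where *: "(\<zero>\<^bsub>Q\<^esub>, y) \<in> G" "G \<in> \<C>" by blast
    show "y = \<zero>\<^bsub>E\<^esub>" using twisted_graph_zeroD[OF tw *(1)] * by blast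
  qed
qed

text \<open>
  Subtracting needs multiplication by \<open>-1\<close>, which does not pick up a Leibniz term because
  derivations kill \<open>-1\<close>.
\<close>

lemma twisted_graph_unique:
  assumes "graded_mod gr cmp Q" "graded_mod gr cmp E" and D: "derivation e D"
    and g: "linear_hom Q E g" and G: "twisted_graph e D g Q E G"
    and xy: "(x, y) \<in> G" and xy': "(x, y') \<in> G"
  shows "y = y'"
proof -
  interpret Q: graded_mod gr cmp Q by fact
  interpret E: graded_mod gr cmp E by fact
  have c: "x \<in> carrier Q" "y \<in> carrier E" "y' \<in> carrier E" "g x \<in> carrier E"
    using twisted_graph_closed[OF G] xy xy' twisted_hom_closed[OF g] by auto
  have "((-1) \<odot>\<^bsub>Q\<^esub> x, (-1) \<odot>\<^bsub>E\<^esub> y') \<in> G"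
    using twisted_graph_smult[OF G xy', of "-1"] c
    by (simp add: derivation_minus_one[OF D] E.smult_0 E.smult_mem)
  from twisted_graph_add[OF G xy this] have "(\<zero>\<^bsub>Q\<^esub>, y \<oplus>\<^bsub>E\<^esub> (-1) \<odot>\<^bsub>E\<^esub> y') \<in> G"
    using c by (simp add: Q.add_uminus)
  then show ?thesis using twisted_graph_zeroD[OF G] E.eq_iff_diff c by blast
qed

text \<open>
  The step of Baer's argument. The set \<open>J\<close> of all \<open>r\<close> for which \<open>r x\<close> is in the domain is a homogeneous ideal,
  and although \<open>r \<mapsto> f (r x)\<close> is not linear, \<open>\<phi> r = f (r x) - D r g x\<close> is: the two Leibniz terms
  cancel. So \<open>\<phi>\<close> is multiplication by some \<open>y\<close>, and \<open>y\<close> can be taken as the value at \<open>x\<close>.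
\<close>

lemma twisted_graph_extend:
  assumes Q: "graded_mod gr cmp Q" and E: "graded_mod gr cmp E" and inj: "graded_injective cring_class_ops gr E"
    and D: "derivation e D" and g: "linear_hom Q E g" and G: "twisted_graph e D g Q E G"
    and x: "x \<in> hpart Q n"
  shows "\<exists>G'. twisted_graph e D g Q E G' \<and> G \<subseteq> G' \<and> (\<exists>y. (x, y) \<in> G')"
proof -
  interpret Q: graded_mod gr cmp Q by fact
  interpret E: graded_mod gr cmp E by fact
  have xc: "x \<in> carrier Q" using x by (rule Q.hpart_carrier)
  have gx: "g x \<in> hpart E n" using twisted_hom_hpart[OF g x] by simp
  have gxc: "g x \<in> carrier E" using gx by (rule E.hpart_carrier)
  have uniq: "y = y'" if "(z, y) \<in> G" "(z, y') \<in> G" for z y y'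
    using twisted_graph_unique[OF Q E D g G that] .
  define J where "J = {r. \<exists>y. (r \<odot>\<^bsub>Q\<^esub> x, y) \<in> G}"
  \<comment> \<open>The value at \<open>r x\<close> of the map given by \<open>G\<close>.\<close>
  define v where "v r = (THE y. (r \<odot>\<^bsub>Q\<^esub> x, y) \<in> G)" for r
  have v: "(r \<odot>\<^bsub>Q\<^esub> x, v r) \<in> G" if "r \<in> J" for r
    using that uniq unfolding J_def v_def by (auto intro: theI2)
  have v_eq: "v r = y" if "(r \<odot>\<^bsub>Q\<^esub> x, y) \<in> G" for r y
    using that uniq unfolding v_def by blast
  have vc: "v r \<in> carrier E" if "r \<in> J" for r using twisted_graph_closed[OF G v[OF that]] by simp
  define \<phi> where "\<phi> r = v r \<oplus>\<^bsub>E\<^esub> (- D r) \<odot>\<^bsub>E\<^esub> g x" for r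
  have G_add: "((r + s) \<odot>\<^bsub>Q\<^esub> x, v r \<oplus>\<^bsub>E\<^esub> v s) \<in> G" if "r \<in> J" "s \<in> J" for r s
    using twisted_graph_add[OF G v[OF that(1)] v[OF that(2)]] xc by (simp add: Q.smult_add_left)
  have G_mult: "((r * s) \<odot>\<^bsub>Q\<^esub> x, r \<odot>\<^bsub>E\<^esub> v s \<oplus>\<^bsub>E\<^esub> (D r * s) \<odot>\<^bsub>E\<^esub> g x) \<in> G" if "s \<in> J" for r s
    using twisted_graph_smult[OF G v[OF that], of r] xc gxc
    by (simp add: Q.smult_mult E.smult_mult linear_hom_smult[OF E g])
  have G_cmp: "(cmp r a \<odot>\<^bsub>Q\<^esub> x, component E (v r) (a + n + e)) \<in> G" if "r \<in> J" for r a
    using twisted_graph_component[OF G v[OF that], of "a + n"] by (simp add: Q.component_smult_on_homogeneous[OF x])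
  obtain y where y: "y \<in> hpart E (n + e)" and y_eq: "\<And>r. r \<in> J \<Longrightarrow> \<phi> r = r \<odot>\<^bsub>E\<^esub> y"
  proof (rule graded_injective_test[OF inj, of J \<phi> "n + e"])
    show "0 \<in> J" using twisted_graph_zero[OF G] xc by (auto simp: J_def Q.smult_0)
    show "r + s \<in> J" if "r \<in> J" "s \<in> J" for r s using G_add[OF that] by (auto simp: J_def)
    show "r * s \<in> J" if "s \<in> J" for r s using G_mult[OF that] unfolding J_def by blast
    show "cmp r a \<in> J" if "r \<in> J" for r a using G_cmp[OF that] by (auto simp: J_def)
    show "\<phi> r \<in> carrier E" if "r \<in> J" for r
      using vc[OF that] gxc by (simp add: \<phi>_def E.smult_mem)
    show "\<phi> (r + s) = \<phi> r \<oplus>\<^bsub>E\<^esub> \<phi> s" if "r \<in> J" "s \<in> J" for r s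
      using vc that gxc v_eq[OF G_add[OF that]] E.smult_add_left[OF gxc, of "- D r" "- D s"]
      by (simp add: \<phi>_def E.smult_mem derivation_add[OF D] E.a_ac)
    show "\<phi> (r * s) = r \<odot>\<^bsub>E\<^esub> \<phi> s" if "s \<in> J" for r s
    proof -
      have "\<phi> (r * s) = r \<odot>\<^bsub>E\<^esub> v s \<oplus>\<^bsub>E\<^esub> ((D r * s) \<odot>\<^bsub>E\<^esub> g x \<oplus>\<^bsub>E\<^esub> (- D (r * s)) \<odot>\<^bsub>E\<^esub> g x)"
        using vc[OF that] gxc by (simp add: \<phi>_def v_eq[OF G_mult[OF that]] E.smult_mem E.a_assoc)
      also have "(D r * s) \<odot>\<^bsub>E\<^esub> g x \<oplus>\<^bsub>E\<^esub> (- D (r * s)) \<odot>\<^bsub>E\<^esub> g x = (r * (- D s)) \<odot>\<^bsub>E\<^esub> g x"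
        using E.smult_add_left[OF gxc, of "D r * s" "- D (r * s)"]
        by (simp add: derivation_mult[OF D] algebra_simps)
      finally show ?thesis
        using vc[OF that] gxc E.smult_mult[OF gxc, of r "- D s"]
        by (simp add: \<phi>_def E.smult_add_right E.smult_mem)
    qed
    show "\<phi> r \<in> hpart E (a + (n + e))" if "r \<in> J" "r \<in> gr a" for r a
    proof -
      have "(r \<odot>\<^bsub>Q\<^esub> x, component E (v r) (a + n + e)) \<in> G"
        using G_cmp[OF that(1), of a] by (simp add: cmp_homogeneous[OF that(2)])
      then have "v r = component E (v r) (a + n + e)" by (rule v_eq)
      then have "v r \<in> hpart E (a + (n + e))"
        using E.component_hpart[OF vc[OF that(1)], of "a + n + e"] by (simp add: add.assoc)
      moreover have "(- D r) \<odot>\<^bsub>E\<^esub> g x \<in> hpart E (a + (n + e))"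
        using E.hpart_smult[OF uminus_gr[OF derivation_gr[OF D that(2)]] gx] by (simp add: ac_simps)
      ultimately show ?thesis unfolding \<phi>_def by (rule E.hpart_add)
    qed
  qed (use that in blast)
  have yc: "y \<in> carrier E" using y by (rule E.hpart_carrier)
  \<comment> \<open>The Leibniz rule forces the extended map to take the value \<open>w r\<close> at \<open>r x\<close>.\<close>
  define w where "w r = r \<odot>\<^bsub>E\<^esub> y \<oplus>\<^bsub>E\<^esub> D r \<odot>\<^bsub>E\<^esub> g x" for r
  have wc: "w r \<in> carrier E" for r using yc gxc by (simp add: w_def E.smult_mem)
  have w_add: "w (r + s) = w r \<oplus>\<^bsub>E\<^esub> w s" for r s
    using yc gxc by (simp add: w_def E.smult_add_left derivation_add[OF D] E.smult_mem E.a_ac)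
  have w_mult: "w (r * s) = r \<odot>\<^bsub>E\<^esub> w s \<oplus>\<^bsub>E\<^esub> D r \<odot>\<^bsub>E\<^esub> (s \<odot>\<^bsub>E\<^esub> g x)" for r s
    using yc gxc
    by (simp add: w_def E.smult_add_left E.smult_add_right derivation_mult[OF D] E.smult_mem E.smult_mult[symmetric]
        E.a_assoc mult.commute)
  have w_v: "w r = v r" if "r \<in> J" for r
  proof -
    have "w r = v r \<oplus>\<^bsub>E\<^esub> ((- D r) \<odot>\<^bsub>E\<^esub> g x \<oplus>\<^bsub>E\<^esub> D r \<odot>\<^bsub>E\<^esub> g x)"
      unfolding w_def y_eq[OF that, symmetric] \<phi>_def using vc[OF that] gxc by (simp add: E.smult_mem E.a_assoc)
    also have "(- D r) \<odot>\<^bsub>E\<^esub> g x \<oplus>\<^bsub>E\<^esub> D r \<odot>\<^bsub>E\<^esub> g x = \<zero>\<^bsub>E\<^esub>"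
      using gxc by (simp add: E.smult_add_left[symmetric] E.smult_0)
    finally show ?thesis using vc[OF that] by simp
  qed
  have w_comp: "component E (w r) (k + e) = w (cmp r (k - n))" for r k
  proof -
    have *: "k - n + n + e = k + e" "k + e - (n + e) = k - n" "k + e - n = k - n + e" by auto
    show ?thesis
      using yc gxc unfolding w_def
      by (simp add: E.component_add E.smult_mem E.component_smult_on_homogeneous[OF y]
        E.component_smult_on_homogeneous[OF gx] derivation_cmp[OF D] *)
  qed
  define G' where "G' = {(p \<oplus>\<^bsub>Q\<^esub> r \<odot>\<^bsub>Q\<^esub> x, q \<oplus>\<^bsub>E\<^esub> w r) | p q r. (p, q) \<in> G}"
  have G'I: "(p \<oplus>\<^bsub>Q\<^esub> r \<odot>\<^bsub>Q\<^esub> x, q \<oplus>\<^bsub>E\<^esub> w r) \<in> G'" if "(p, q) \<in> G" for p q r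
    using that unfolding G'_def by blast
  have w0: "w 0 = \<zero>\<^bsub>E\<^esub>" and w1: "w 1 = y"
    using yc gxc derivation_mult[OF D, of 1 1] by (auto simp: w_def derivation_zero[OF D] E.smult_0 E.smult_1)
  have "G \<subseteq> G'"
  proof
    fix z assume z: "z \<in> G"
    obtain p q where pq: "z = (p, q)" by (cases z)
    show "z \<in> G'" using z G'I[of p q 0] twisted_graph_closed[OF G, of p q] xc by (simp add: pq w0 Q.smult_0)
  qed
  moreover have "(x, y) \<in> G'"
    using G'I[OF twisted_graph_zero[OF G], of 1] xc yc by (simp add: w1 Q.smult_1)
  moreover have "twisted_graph e D g Q E G'"
    unfolding twisted_graph_def
  proof (intro conjI allI impI)
    show "G' \<subseteq> carrier Q \<times> carrier E"
      using twisted_graph_closed[OF G] xc wc by (auto simp: G'_def Q.smult_mem)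
    show "(\<zero>\<^bsub>Q\<^esub>, \<zero>\<^bsub>E\<^esub>) \<in> G'" using twisted_graph_zero[OF G] \<open>G \<subseteq> G'\<close> by blast
  next
    fix z u z' u' assume "(z, u) \<in> G'" "(z', u') \<in> G'"
    then obtain p q r p' q' r' where *: "(p, q) \<in> G" "(p', q') \<in> G"
      "z = p \<oplus>\<^bsub>Q\<^esub> r \<odot>\<^bsub>Q\<^esub> x" "u = q \<oplus>\<^bsub>E\<^esub> w r" "z' = p' \<oplus>\<^bsub>Q\<^esub> r' \<odot>\<^bsub>Q\<^esub> x" "u' = q' \<oplus>\<^bsub>E\<^esub> w r'"
      unfolding G'_def by blast
    have c: "p \<in> carrier Q" "q \<in> carrier E" "p' \<in> carrier Q" "q' \<in> carrier E"
      using twisted_graph_closed[OF G] *(1,2) by auto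
    have "z \<oplus>\<^bsub>Q\<^esub> z' = (p \<oplus>\<^bsub>Q\<^esub> p') \<oplus>\<^bsub>Q\<^esub> (r + r') \<odot>\<^bsub>Q\<^esub> x"
      using c xc by (simp add: * Q.smult_add_left Q.smult_mem Q.a_ac)
    moreover have "u \<oplus>\<^bsub>E\<^esub> u' = (q \<oplus>\<^bsub>E\<^esub> q') \<oplus>\<^bsub>E\<^esub> w (r + r')"
      using c wc by (simp add: * w_add E.a_ac)
    ultimately show "(z \<oplus>\<^bsub>Q\<^esub> z', u \<oplus>\<^bsub>E\<^esub> u') \<in> G'" using G'I[OF twisted_graph_add[OF G *(1,2)]] by simp
  next
    fix s z u assume "(z, u) \<in> G'"
    then obtain p q r where *: "(p, q) \<in> G" "z = p \<oplus>\<^bsub>Q\<^esub> r \<odot>\<^bsub>Q\<^esub> x" "u = q \<oplus>\<^bsub>E\<^esub> w r"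
      unfolding G'_def by blast
    have c: "p \<in> carrier Q" "q \<in> carrier E" "g p \<in> carrier E"
      using twisted_graph_closed[OF G] *(1) twisted_hom_closed[OF g] by auto
    have "s \<odot>\<^bsub>Q\<^esub> z = s \<odot>\<^bsub>Q\<^esub> p \<oplus>\<^bsub>Q\<^esub> (s * r) \<odot>\<^bsub>Q\<^esub> x"
      using c xc by (simp add: * Q.smult_add_right Q.smult_mem Q.smult_mult)
    moreover have "s \<odot>\<^bsub>E\<^esub> u \<oplus>\<^bsub>E\<^esub> D s \<odot>\<^bsub>E\<^esub> g z = (s \<odot>\<^bsub>E\<^esub> q \<oplus>\<^bsub>E\<^esub> D s \<odot>\<^bsub>E\<^esub> g p) \<oplus>\<^bsub>E\<^esub> w (s * r)"
      using c xc wc gxc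
      by (simp add: * w_mult twisted_hom_add[OF g] Q.smult_mem linear_hom_smult[OF E g] E.smult_add_right
          E.smult_mem E.a_ac)
    ultimately show "(s \<odot>\<^bsub>Q\<^esub> z, s \<odot>\<^bsub>E\<^esub> u \<oplus>\<^bsub>E\<^esub> D s \<odot>\<^bsub>E\<^esub> g z) \<in> G'"
      using G'I[OF twisted_graph_smult[OF G *(1), of s]] by simp
  next
    fix k z u assume "(z, u) \<in> G'"
    then obtain p q r where *: "(p, q) \<in> G" "z = p \<oplus>\<^bsub>Q\<^esub> r \<odot>\<^bsub>Q\<^esub> x" "u = q \<oplus>\<^bsub>E\<^esub> w r"
      unfolding G'_def by blast
    have c: "p \<in> carrier Q" "q \<in> carrier E" using twisted_graph_closed[OF G] *(1) by auto
    have "component Q z k = component Q p k \<oplus>\<^bsub>Q\<^esub> cmp r (k - n) \<odot>\<^bsub>Q\<^esub> x"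
      using c xc by (simp add: * Q.component_add Q.smult_mem Q.component_smult_on_homogeneous[OF x])
    moreover have "component E u (k + e) = component E q (k + e) \<oplus>\<^bsub>E\<^esub> w (cmp r (k - n))"
      using c wc by (simp add: * E.component_add w_comp)
    ultimately show "(component Q z k, component E u (k + e)) \<in> G'"
      using G'I[OF twisted_graph_component[OF G *(1), of k]] by simp
  next
    fix u assume "(\<zero>\<^bsub>Q\<^esub>, u) \<in> G'"
    then obtain p q r where *: "(p, q) \<in> G" "\<zero>\<^bsub>Q\<^esub> = p \<oplus>\<^bsub>Q\<^esub> r \<odot>\<^bsub>Q\<^esub> x" "u = q \<oplus>\<^bsub>E\<^esub> w r"
      unfolding G'_def by blast
    have c: "p \<in> carrier Q" "q \<in> carrier E" "g p \<in> carrier E"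
      using twisted_graph_closed[OF G] *(1) twisted_hom_closed[OF g] by auto
    have "r \<odot>\<^bsub>Q\<^esub> x = (-1) \<odot>\<^bsub>Q\<^esub> p"
      using *(2) c xc by (metis Q.smult_mem Q.smult_m1 Q.minus_equality Q.a_comm)
    moreover have "((-1) \<odot>\<^bsub>Q\<^esub> p, (-1) \<odot>\<^bsub>E\<^esub> q) \<in> G"
      using twisted_graph_smult[OF G *(1), of "-1"] c
      by (simp add: derivation_minus_one[OF D] E.smult_0 E.smult_mem)
    ultimately have rG: "(r \<odot>\<^bsub>Q\<^esub> x, (-1) \<odot>\<^bsub>E\<^esub> q) \<in> G" by simp
    then have "w r = (-1) \<odot>\<^bsub>E\<^esub> q" using w_v[of r] v_eq[OF rG] unfolding J_def by auto
    then show "u = \<zero>\<^bsub>E\<^esub>" using c by (simp add: * E.add_uminus)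
  qed
  ultimately show ?thesis by blast
qed

text \<open>
  The definition of a graded injective module tests extension only against modules made of ring
  elements. By Zorn's lemma, extension along every graded submodule of a module over an arbitrary type
  follows, also for maps with a Leibniz rule.
\<close>

lemma twisted_hom_extension:
  assumes inj: "graded_injective cring_class_ops gr E" and Q: "graded_mod gr cmp Q"
    and D: "derivation e D" and g: "linear_hom Q E g" and G: "twisted_graph e D g Q E G"
  obtains f where "twisted_hom e D g Q E f" "\<And>x y. (x, y) \<in> G \<Longrightarrow> f x = y"
proof -
  have E: "graded_mod gr cmp E"
    using inj graded_comm_ring_axioms by (simp add: graded_injective_def graded_mod_def graded_mod_axioms_def)
  interpret Q: graded_mod gr cmp Q by fact
  interpret E: graded_mod gr cmp E by fact
  let ?A = "{H. twisted_graph e D g Q E H \<and> G \<subseteq> H}"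
  have "\<exists>H \<in> ?A. \<forall>H' \<in> ?A. H \<subseteq> H' \<longrightarrow> H' = H"
  proof (rule subset_Zorn_nonempty)
    show "?A \<noteq> {}" using G by blast
    show "\<Union>\<C> \<in> ?A" if ne: "\<C> \<noteq> {}" and "subset.chain ?A \<C>" for \<C>
    proof -
      have \<C>: "\<C> \<subseteq> ?A" "\<forall>U \<in> \<C>. \<forall>V \<in> \<C>. U \<subseteq> V \<or> V \<subseteq> U"
        using that(2) by (simp_all add: subset_chain_def)
      have "subset.chain {H. twisted_graph e D g Q E H} \<C>"
        using \<C> by (auto simp: subset_chain_def)
      then have "twisted_graph e D g Q E (\<Union>\<C>)" by (rule twisted_graph_Union[OF that(1)])
      moreover obtain U where "U \<in> \<C>" using ne by blast
      then have "G \<subseteq> \<Union>\<C>" using \<C>(1) by fastforce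
      ultimately show ?thesis by simp
    qed
  qed
  then obtain H where H: "twisted_graph e D g Q E H" "G \<subseteq> H"
    and max: "\<And>U. twisted_graph e D g Q E U \<Longrightarrow> H \<subseteq> U \<Longrightarrow> U = H"
    by (smt (verit) mem_Collect_eq order_trans)
  have total: "\<exists>y. (x, y) \<in> H" if "x \<in> carrier Q" for x
    using that
  proof (induction rule: Q.homogeneous_induct)
    case (homogeneous k x)
    then show ?case using twisted_graph_extend[OF Q E inj D g H(1) homogeneous] max by metis
  next
    case (add x y)
    then show ?case using twisted_graph_add[OF H(1)] by blast
  qed
  define f where "f x = (THE y. (x, y) \<in> H)" for x
  have f_eq: "f x = y" if "(x, y) \<in> H" for x y
    using that twisted_graph_unique[OF Q E D g H(1)] unfolding f_def by blast
  have fH: "(x, f x) \<in> H" if "x \<in> carrier Q" for x using total[OF that] f_eq by blast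
  show thesis
  proof
    show "f x = y" if "(x, y) \<in> G" for x y using f_eq that H(2) by blast
    show "twisted_hom e D g Q E f"
      unfolding twisted_hom_def
    proof (intro conjI allI ballI)
      show "f \<in> carrier Q \<rightarrow> carrier E" using fH twisted_graph_closed[OF H(1)] by blast
      show "f (x \<oplus>\<^bsub>Q\<^esub> y) = f x \<oplus>\<^bsub>E\<^esub> f y" if "x \<in> carrier Q" "y \<in> carrier Q" for x y
        using twisted_graph_add[OF H(1) fH fH] that f_eq by blast
      show "f (r \<odot>\<^bsub>Q\<^esub> x) = r \<odot>\<^bsub>E\<^esub> f x \<oplus>\<^bsub>E\<^esub> D r \<odot>\<^bsub>E\<^esub> g x" if "x \<in> carrier Q" for r x
        using twisted_graph_smult[OF H(1) fH] that f_eq by blast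
      show "f x \<in> hpart E (n + e)" if "x \<in> hpart Q n" for n x
      proof -
        have xc: "x \<in> carrier Q" using that by (rule Q.hpart_carrier)
        have "(x, component E (f x) (n + e)) \<in> H"
          using twisted_graph_component[OF H(1) fH[OF xc], of n] that
          by (simp add: Q.component_homogeneous)
        then have "f x = component E (f x) (n + e)" by (rule f_eq)
        then show ?thesis using E.component_hpart twisted_graph_closed[OF H(1) fH[OF xc]] by metis
      qed
    qed
  qed
qed

text \<open>
  Extension along a map \<open>u\<close> that may have a kernel, provided that the given map vanishes there:
  the partial map that is extended lives on the image of \<open>u\<close>.
\<close>

lemma twisted_hom_extension_along:
  assumes inj: "graded_injective cring_class_ops gr E" and P: "graded_mod gr cmp P" and Q: "graded_mod gr cmp Q"
    and D: "derivation e D" and g: "linear_hom Q E g" and u: "linear_hom P Q u"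
    and \<phi>: "twisted_hom e D (\<lambda>x. g (u x)) P E \<phi>"
    and ker: "\<And>x. x \<in> carrier P \<Longrightarrow> u x = \<zero>\<^bsub>Q\<^esub> \<Longrightarrow> \<phi> x = \<zero>\<^bsub>E\<^esub>"
  obtains f where "twisted_hom e D g Q E f" "\<And>x. x \<in> carrier P \<Longrightarrow> f (u x) = \<phi> x"
proof -
  have E: "graded_mod gr cmp E"
    using inj graded_comm_ring_axioms by (simp add: graded_injective_def graded_mod_def graded_mod_axioms_def)
  interpret P: graded_mod gr cmp P by fact
  interpret Q: graded_mod gr cmp Q by fact
  interpret E: graded_mod gr cmp E by fact
  let ?G = "{(u x, \<phi> x) | x. x \<in> carrier P}"
  have I: "(u x, \<phi> x) \<in> ?G" if "x \<in> carrier P" for x using that by blast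
  have "twisted_graph e D g Q E ?G"
    unfolding twisted_graph_def
  proof (intro conjI allI impI)
    show "?G \<subseteq> carrier Q \<times> carrier E"
      using twisted_hom_closed[OF u] twisted_hom_closed[OF \<phi>] by blast
    show "(\<zero>\<^bsub>Q\<^esub>, \<zero>\<^bsub>E\<^esub>) \<in> ?G"
      using I[OF P.zero_closed] by (simp add: twisted_hom_zero[OF P Q u] twisted_hom_zero[OF P E \<phi>])
  next
    fix x y x' y' assume "(x, y) \<in> ?G" "(x', y') \<in> ?G"
    then obtain p p' where *: "x = u p" "y = \<phi> p" "x' = u p'" "y' = \<phi> p'" "p \<in> carrier P" "p' \<in> carrier P"
      by blast
    show "(x \<oplus>\<^bsub>Q\<^esub> x', y \<oplus>\<^bsub>E\<^esub> y') \<in> ?G"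
      using I[of "p \<oplus>\<^bsub>P\<^esub> p'"] * by (simp add: twisted_hom_add[OF u] twisted_hom_add[OF \<phi>])
  next
    fix r x y assume "(x, y) \<in> ?G"
    then obtain p where *: "x = u p" "y = \<phi> p" "p \<in> carrier P" by blast
    show "(r \<odot>\<^bsub>Q\<^esub> x, r \<odot>\<^bsub>E\<^esub> y \<oplus>\<^bsub>E\<^esub> D r \<odot>\<^bsub>E\<^esub> g x) \<in> ?G"
      using I[OF P.smult_mem[OF *(3), of r]] *
      by (simp add: linear_hom_smult[OF Q u] twisted_hom_smult[OF \<phi>])
  next
    fix n x y assume "(x, y) \<in> ?G"
    then obtain p where *: "x = u p" "y = \<phi> p" "p \<in> carrier P" by blast
    show "(component Q x n, component E y (n + e)) \<in> ?G"
      using I[OF P.component_carrier[OF *(3), of n]] *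
        twisted_hom_component[OF P Q u *(3), of n] twisted_hom_component[OF P E \<phi> *(3), of n] by simp
  next
    fix y assume "(\<zero>\<^bsub>Q\<^esub>, y) \<in> ?G"
    then show "y = \<zero>\<^bsub>E\<^esub>" using ker by auto
  qed
  then show thesis
    using twisted_hom_extension[OF inj Q D g] that I by (metis (no_types, lifting))
qed

section \<open>Operations on maps with a Leibniz rule\<close>

lemma derivation_plus:
  assumes "derivation e D" "derivation e D'" shows "derivation e (\<lambda>r. D r + D' r)"
  using assms by (auto simp: derivation_def add_gr algebra_simps)

lemma derivation_scale:
  assumes "derivation e D" "s \<in> gr b" shows "derivation (b + e) (\<lambda>r. s * D r)"
proof -
  have "s * D r \<in> gr (a + (b + e))" if "r \<in> gr a" for r a
    using mult_gr[OF assms(2) derivation_gr[OF assms(1) that]] by (simp add: ac_simps)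
  then show ?thesis using assms(1) by (auto simp: derivation_def algebra_simps)
qed

lemma derivation_sum:
  assumes "finite F" "\<And>k. k \<in> F \<Longrightarrow> derivation e (D k)" shows "derivation e (\<lambda>r. \<Sum>k\<in>F. D k r)"
  using assms by (induction F rule: finite_induct) (auto simp: derivation_null derivation_plus)

lemma twisted_hom_plus:
  assumes E: "graded_mod gr cmp E" and g: "\<And>x. x \<in> carrier Q \<Longrightarrow> g x \<in> carrier E"
    and f: "twisted_hom e D g Q E f" and f': "twisted_hom e D' g Q E f'"
  shows "twisted_hom e (\<lambda>r. D r + D' r) g Q E (\<lambda>x. f x \<oplus>\<^bsub>E\<^esub> f' x)"
proof -
  interpret E: graded_mod gr cmp E by fact
  note c = twisted_hom_closed[OF f] twisted_hom_closed[OF f']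
  show ?thesis
    unfolding twisted_hom_def
  proof (intro conjI allI ballI)
    fix x y assume "x \<in> carrier Q" "y \<in> carrier Q"
    then show "f (x \<oplus>\<^bsub>Q\<^esub> y) \<oplus>\<^bsub>E\<^esub> f' (x \<oplus>\<^bsub>Q\<^esub> y) = f x \<oplus>\<^bsub>E\<^esub> f' x \<oplus>\<^bsub>E\<^esub> (f y \<oplus>\<^bsub>E\<^esub> f' y)"
      by (simp add: twisted_hom_add[OF f] twisted_hom_add[OF f'] c E.a_ac)
  next
    fix r x assume "x \<in> carrier Q"
    then show "f (r \<odot>\<^bsub>Q\<^esub> x) \<oplus>\<^bsub>E\<^esub> f' (r \<odot>\<^bsub>Q\<^esub> x) =
        r \<odot>\<^bsub>E\<^esub> (f x \<oplus>\<^bsub>E\<^esub> f' x) \<oplus>\<^bsub>E\<^esub> (D r + D' r) \<odot>\<^bsub>E\<^esub> g x"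
      by (simp add: twisted_hom_smult[OF f] twisted_hom_smult[OF f'] c g E.smult_add_left E.smult_add_right
          E.smult_mem E.a_ac)
  qed (auto simp: c intro!: E.hpart_add twisted_hom_hpart[OF f] twisted_hom_hpart[OF f'])
qed

lemma twisted_hom_scale:
  assumes E: "graded_mod gr cmp E" and g: "\<And>x. x \<in> carrier Q \<Longrightarrow> g x \<in> carrier E"
    and f: "twisted_hom e D g Q E f" and s: "s \<in> gr b"
  shows "twisted_hom (b + e) (\<lambda>r. s * D r) g Q E (\<lambda>x. s \<odot>\<^bsub>E\<^esub> f x)"
proof -
  interpret E: graded_mod gr cmp E by fact
  note c = twisted_hom_closed[OF f]
  show ?thesis
    unfolding twisted_hom_def
  proof (intro conjI allI ballI)
    fix x y assume "x \<in> carrier Q" "y \<in> carrier Q"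
    then show "s \<odot>\<^bsub>E\<^esub> f (x \<oplus>\<^bsub>Q\<^esub> y) = s \<odot>\<^bsub>E\<^esub> f x \<oplus>\<^bsub>E\<^esub> s \<odot>\<^bsub>E\<^esub> f y"
      by (simp add: twisted_hom_add[OF f] c E.smult_add_right)
  next
    fix r x assume x: "x \<in> carrier Q"
    have "s \<odot>\<^bsub>E\<^esub> (r \<odot>\<^bsub>E\<^esub> f x) = r \<odot>\<^bsub>E\<^esub> (s \<odot>\<^bsub>E\<^esub> f x)"
      using E.smult_mult[OF c[OF x], of s r] E.smult_mult[OF c[OF x], of r s] by (simp add: mult.commute)
    then show "s \<odot>\<^bsub>E\<^esub> f (r \<odot>\<^bsub>Q\<^esub> x) = r \<odot>\<^bsub>E\<^esub> (s \<odot>\<^bsub>E\<^esub> f x) \<oplus>\<^bsub>E\<^esub> (s * D r) \<odot>\<^bsub>E\<^esub> g x"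
      using x by (simp add: twisted_hom_smult[OF f] c g E.smult_add_right E.smult_mem E.smult_mult)
  next
    fix n x assume "x \<in> hpart Q n"
    from E.hpart_smult[OF s twisted_hom_hpart[OF f this]]
    show "s \<odot>\<^bsub>E\<^esub> f x \<in> hpart E (n + (b + e))" by (simp add: ac_simps)
  qed (auto simp: c E.smult_mem)
qed

lemma twisted_hom_null:
  assumes "graded_mod gr cmp E" and "\<And>x. x \<in> carrier Q \<Longrightarrow> g x \<in> carrier E"
  shows "twisted_hom e (\<lambda>_. 0) g Q E (\<lambda>_. \<zero>\<^bsub>E\<^esub>)"
proof -
  interpret E: graded_mod gr cmp E by fact
  show ?thesis using assms(2) by (auto simp: twisted_hom_def E.smult_0 E.smult_zero E.hpart_zero)
qed

lemma twisted_hom_cong_twist: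
  assumes "graded_mod gr cmp E" and "\<And>x. x \<in> carrier Q \<Longrightarrow> g x \<in> carrier E"
    and "\<And>x. x \<in> carrier Q \<Longrightarrow> g' x \<in> carrier E" and "twisted_hom e (\<lambda>_. 0) g Q E f"
  shows "twisted_hom e (\<lambda>_. 0) g' Q E f"
proof -
  interpret E: graded_mod gr cmp E by fact
  show ?thesis using assms(2-) by (simp add: twisted_hom_def E.smult_0)
qed

lemma linear_hom_comp:
  assumes "graded_mod gr cmp E" "graded_mod gr cmp F" "linear_hom Q E f" "linear_hom E F h"
  shows "linear_hom Q F (\<lambda>x. h (f x))"
  using assms(3,4) unfolding linear_hom_iff[OF assms(1)] linear_hom_iff[OF assms(2)]
  by (auto simp: graded_hom_def Pi_iff image_subset_iff)

section \<open>The degree operator\<close>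

lemma leibniz_from_homogeneous:
  assumes E: "graded_mod gr cmp E" and Q: "graded_mod gr cmp Q"
    and D: "derivation e D" and x: "x \<in> carrier Q" and gx: "g x \<in> carrier E"
    and closed: "\<And>x. x \<in> carrier Q \<Longrightarrow> f x \<in> carrier E"
    and add: "\<And>x y. x \<in> carrier Q \<Longrightarrow> y \<in> carrier Q \<Longrightarrow> f (x \<oplus>\<^bsub>Q\<^esub> y) = f x \<oplus>\<^bsub>E\<^esub> f y"
    and hom: "\<And>a r. r \<in> gr a \<Longrightarrow> f (r \<odot>\<^bsub>Q\<^esub> x) = r \<odot>\<^bsub>E\<^esub> f x \<oplus>\<^bsub>E\<^esub> D r \<odot>\<^bsub>E\<^esub> g x"
  shows "f (r \<odot>\<^bsub>Q\<^esub> x) = r \<odot>\<^bsub>E\<^esub> f x \<oplus>\<^bsub>E\<^esub> D r \<odot>\<^bsub>E\<^esub> g x"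
proof -
  interpret E: graded_mod gr cmp E by fact
  interpret Q: graded_mod gr cmp Q by fact
  show ?thesis
  proof (induction r rule: homogeneous_ring_induct)
    case (1 a r)
    then show ?case by (rule hom)
  next
    case (2 r s)
    then show ?case
      using x gx closed[OF x]
      by (simp add: Q.smult_add_left add Q.smult_mem E.smult_add_left E.smult_mem derivation_add[OF D] E.a_ac)
  qed
qed

text \<open>
  Describing the value by its components, rather than as a sum over the support, allows equations
  between such maps to be checked degree by degree.
\<close>

definition degree_op :: "('r, 'e) gmodule \<Rightarrow> 'e \<Rightarrow> 'e" where
  "degree_op N x = (THE y. y \<in> carrier N \<and> (\<forall>n. component N y n = of_int n \<odot>\<^bsub>N\<^esub> component N x n))"

lemma
  assumes N: "graded_mod gr cmp N" and x: "x \<in> carrier N"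
  shows degree_op_closed: "degree_op N x \<in> carrier N"
    and component_degree_op: "component N (degree_op N x) n = of_int n \<odot>\<^bsub>N\<^esub> component N x n"
proof -
  interpret N: graded_mod gr cmp N by fact
  have "\<exists>y\<in>carrier N. \<forall>n. component N y n = of_int n \<odot>\<^bsub>N\<^esub> component N x n"
    using x
  proof (induction rule: N.homogeneous_induct)
    case (homogeneous k x)
    have kx: "of_int k \<odot>\<^bsub>N\<^esub> x \<in> hpart N k" using N.hpart_smult[OF of_int_gr homogeneous] by simp
    show ?case
      using N.component_homogeneous[OF homogeneous] N.component_homogeneous[OF kx] N.hpart_carrier[OF kx]
      by (intro bexI[of _ "of_int k \<odot>\<^bsub>N\<^esub> x"]) (auto simp: N.smult_zero)
  next
    case (add x y)
    then obtain x' y' where *: "x' \<in> carrier N" "y' \<in> carrier N"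
      "\<And>n. component N x' n = of_int n \<odot>\<^bsub>N\<^esub> component N x n"
      "\<And>n. component N y' n = of_int n \<odot>\<^bsub>N\<^esub> component N y n" by metis
    then show ?case
      using add(1,2)
      by (intro bexI[of _ "x' \<oplus>\<^bsub>N\<^esub> y'"]) (auto simp: N.component_add N.smult_add_right N.component_carrier)
  qed
  then have "\<exists>!y. y \<in> carrier N \<and> (\<forall>n. component N y n = of_int n \<odot>\<^bsub>N\<^esub> component N x n)"
    using N.component_eqI by (metis (no_types, lifting))
  from theI'[OF this, folded degree_op_def]
  show "degree_op N x \<in> carrier N" "component N (degree_op N x) n = of_int n \<odot>\<^bsub>N\<^esub> component N x n"
    by blast+
qed

lemma degree_op_homogeneous:
  assumes N: "graded_mod gr cmp N" and x: "x \<in> hpart N k"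
  shows "degree_op N x = of_int k \<odot>\<^bsub>N\<^esub> x"
proof -
  interpret N: graded_mod gr cmp N by fact
  have xc: "x \<in> carrier N" using x by (rule N.hpart_carrier)
  have kx: "of_int k \<odot>\<^bsub>N\<^esub> x \<in> hpart N k" using N.hpart_smult[OF of_int_gr x] by simp
  show ?thesis
  proof (rule N.component_eqI)
    show "component N (degree_op N x) n = component N (of_int k \<odot>\<^bsub>N\<^esub> x) n" for n
      by (simp add: component_degree_op[OF N xc] N.component_homogeneous[OF x]
        N.component_homogeneous[OF kx] N.smult_zero)
  qed (simp_all add: degree_op_closed[OF N xc] N.smult_mem xc)
qed

lemma degree_op_add:
  assumes N: "graded_mod gr cmp N" and x: "x \<in> carrier N" and y: "y \<in> carrier N"
  shows "degree_op N (x \<oplus>\<^bsub>N\<^esub> y) = degree_op N x \<oplus>\<^bsub>N\<^esub> degree_op N y"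
proof -
  interpret N: graded_mod gr cmp N by fact
  show ?thesis
  proof (rule N.component_eqI)
    show "component N (degree_op N (x \<oplus>\<^bsub>N\<^esub> y)) n = component N (degree_op N x \<oplus>\<^bsub>N\<^esub> degree_op N y) n" for n
      using x y
      by (simp add: degree_op_closed[OF N] component_degree_op[OF N] N.component_add N.component_carrier
        N.smult_add_right)
  qed (simp_all add: x y degree_op_closed[OF N])
qed

text \<open>
  Multiplication by the degree obeys the Leibniz rule over the Euler derivation, since degrees add
  under the action of the ring.
\<close>

lemma twisted_hom_degree_op:
  assumes N: "graded_mod gr cmp N" and Eu: "derivation 0 Eu"
    and Euler: "\<And>a r. r \<in> gr a \<Longrightarrow> Eu r = of_int a * r"
  shows "twisted_hom 0 Eu (\<lambda>x. x) N N (degree_op N)"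
proof -
  interpret N: graded_mod gr cmp N by fact
  have *: "degree_op N (r \<odot>\<^bsub>N\<^esub> x) = r \<odot>\<^bsub>N\<^esub> degree_op N x \<oplus>\<^bsub>N\<^esub> Eu r \<odot>\<^bsub>N\<^esub> x"
    if r: "r \<in> gr a" and x: "x \<in> carrier N" for r x a
    using x
  proof (induction rule: N.homogeneous_induct)
    case (homogeneous k x)
    have xc: "x \<in> carrier N" using homogeneous by (rule N.hpart_carrier)
    have "degree_op N (r \<odot>\<^bsub>N\<^esub> x) = (of_int (a + k) * r) \<odot>\<^bsub>N\<^esub> x"
      using degree_op_homogeneous[OF N N.hpart_smult[OF r homogeneous]] xc by (simp add: N.smult_mult)
    also have "of_int (a + k) * r = r * of_int k + Eu r" by (simp add: Euler[OF r] algebra_simps)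
    finally show ?case
      using xc by (simp add: degree_op_homogeneous[OF N homogeneous] N.smult_add_left N.smult_mult)
  next
    case (add x y)
    then show ?case
      by (simp add: N.smult_add_right degree_op_add[OF N] N.smult_mem degree_op_closed[OF N] N.a_ac)
  qed
  show ?thesis
    unfolding twisted_hom_def
  proof (intro conjI allI ballI)
    show "degree_op N \<in> carrier N \<rightarrow> carrier N" by (simp add: degree_op_closed[OF N])
    show "degree_op N (x \<oplus>\<^bsub>N\<^esub> y) = degree_op N x \<oplus>\<^bsub>N\<^esub> degree_op N y"
      if "x \<in> carrier N" "y \<in> carrier N" for x y using that by (rule degree_op_add[OF N])
    show "degree_op N (r \<odot>\<^bsub>N\<^esub> x) = r \<odot>\<^bsub>N\<^esub> degree_op N x \<oplus>\<^bsub>N\<^esub> Eu r \<odot>\<^bsub>N\<^esub> x" if "x \<in> carrier N" for r x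
      by (rule leibniz_from_homogeneous[OF N N Eu])
        (simp_all add: that * degree_op_closed[OF N] degree_op_add[OF N])
    show "degree_op N x \<in> hpart N (n + 0)" if "x \<in> hpart N n" for n x
      using N.hpart_smult[OF of_int_gr that] by (simp add: degree_op_homogeneous[OF N that])
  qed
qed

lemma degree_op_natural:
  assumes N: "graded_mod gr cmp N" and N': "graded_mod gr cmp N'" and u: "linear_hom N N' u"
    and x: "x \<in> carrier N"
  shows "degree_op N' (u x) = u (degree_op N x)"
proof -
  interpret N: graded_mod gr cmp N by fact
  interpret N': graded_mod gr cmp N' by fact
  show ?thesis using x
  proof (induction rule: N.homogeneous_induct)
    case (homogeneous k x)
    have ux: "u x \<in> hpart N' k" using twisted_hom_hpart[OF u homogeneous] by simp
    show ?case
      using N.hpart_carrier[OF homogeneous]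
      by (simp add: degree_op_homogeneous[OF N homogeneous] degree_op_homogeneous[OF N' ux] linear_hom_smult[OF N' u])
  next
    case (add x y)
    then show ?case
      by (simp add: degree_op_add[OF N] degree_op_add[OF N'] twisted_hom_add[OF u] twisted_hom_closed[OF u]
          degree_op_closed[OF N])
  qed
qed

lemma graded_mod_self: "graded_mod gr cmp (self_gmodule cring_class_ops gr)"
  unfolding self_gmodule_eq graded_mod_def graded_mod_axioms_def
  by (intro conjI graded_comm_ring_axioms graded_module_shifted_ideal) auto

end

section \<open>Lifting derivations to an injective resolution\<close>

locale graded_resolution = graded_comm_ring gr cmp
  for gr :: "int \<Rightarrow> 'r::comm_ring_1 set" and cmp :: "'r \<Rightarrow> int \<Rightarrow> 'r" +
  fixes E :: "nat \<Rightarrow> ('r, 'e) gmodule" and \<epsilon> :: "'r \<Rightarrow> 'e" and d :: "nat \<Rightarrow> 'e \<Rightarrow> 'e"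
  assumes resolution: "graded_injective_resolution cring_class_ops gr (self_gmodule cring_class_ops gr) E \<epsilon> d"
begin

lemma injective: "graded_injective cring_class_ops gr (E j)"
  using resolution by (simp add: graded_injective_resolution_def)

lemma graded_mod_E: "graded_mod gr cmp (E j)"
  using injective[of j] graded_comm_ring_axioms
  by (simp add: graded_injective_def graded_mod_def graded_mod_axioms_def)

sublocale E: graded_mod gr cmp "E j" for j
  by (rule graded_mod_E)

lemma linear_\<epsilon>: "linear_hom (shifted_ideal UNIV 0) (E 0) \<epsilon>"
  using resolution
  by (simp add: graded_injective_resolution_def linear_hom_iff[OF graded_mod_E] self_gmodule_eq)

lemma linear_d: "linear_hom (E j) (E (Suc j)) (d j)"
  using resolution
  by (simp add: graded_injective_resolution_def linear_hom_iff[OF graded_mod_E])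

lemma \<epsilon>_closed: "\<epsilon> r \<in> carrier (E 0)"
  using twisted_hom_closed[OF linear_\<epsilon>, of r] by simp

lemma d_closed: "x \<in> carrier (E j) \<Longrightarrow> d j x \<in> carrier (E (Suc j))"
  using twisted_hom_closed[OF linear_d] .

lemma d_add:
  "x \<in> carrier (E j) \<Longrightarrow> y \<in> carrier (E j) \<Longrightarrow> d j (x \<oplus>\<^bsub>E j\<^esub> y) = d j x \<oplus>\<^bsub>E (Suc j)\<^esub> d j y"
  using twisted_hom_add[OF linear_d] .

lemma d_smult: "x \<in> carrier (E j) \<Longrightarrow> d j (r \<odot>\<^bsub>E j\<^esub> x) = r \<odot>\<^bsub>E (Suc j)\<^esub> d j x"
  using linear_hom_smult[OF graded_mod_E linear_d] .

lemma d_zero: "d j \<zero>\<^bsub>E j\<^esub> = \<zero>\<^bsub>E (Suc j)\<^esub>"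
  using twisted_hom_zero[OF graded_mod_E graded_mod_E linear_d] .

lemma a_kernel_iff: "x \<in> a_kernel (E i) (E j) f \<longleftrightarrow> x \<in> carrier (E i) \<and> f x = \<zero>\<^bsub>E j\<^esub>"
  by (simp add: a_kernel_def kernel_def)

lemma exact_0: "x \<in> carrier (E 0) \<Longrightarrow> d 0 x = \<zero>\<^bsub>E (Suc 0)\<^esub> \<longleftrightarrow> x \<in> range \<epsilon>"
  using resolution a_kernel_iff[of x 0 "Suc 0" "d 0"]
  by (simp add: graded_injective_resolution_def self_gmodule_eq)

lemma exact_Suc:
  "x \<in> carrier (E (Suc j)) \<Longrightarrow> d (Suc j) x = \<zero>\<^bsub>E (Suc (Suc j))\<^esub> \<longleftrightarrow> x \<in> d j ` carrier (E j)"
  using resolution a_kernel_iff[of x "Suc j" "Suc (Suc j)" "d (Suc j)"]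
  by (simp add: graded_injective_resolution_def)

lemma d_d: "x \<in> carrier (E j) \<Longrightarrow> d (Suc j) (d j x) = \<zero>\<^bsub>E (Suc (Suc j))\<^esub>"
  using exact_Suc[of "d j x" j] d_closed by blast

lemma inj_\<epsilon>: "inj \<epsilon>"
  using resolution by (simp add: graded_injective_resolution_def self_gmodule_eq)

lemma \<epsilon>_zero: "\<epsilon> 0 = \<zero>\<^bsub>E 0\<^esub>"
  using twisted_hom_zero[OF graded_mod_self graded_mod_E, unfolded self_gmodule_eq, OF linear_\<epsilon>] by simp

lemma linear_id: "linear_hom (E j) (E j) (\<lambda>x. x)"
  by (auto simp: twisted_hom_def E.smult_0 E.smult_mem)

text \<open>
  The counterpart, for a derivation, of a chain map over a given linear map in the comparison theorem for
  resolutions.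
\<close>

definition lift_of :: "int \<Rightarrow> ('r \<Rightarrow> 'r) \<Rightarrow> (nat \<Rightarrow> 'e \<Rightarrow> 'e) \<Rightarrow> bool" where
  "lift_of e D \<delta> \<longleftrightarrow>
     (\<forall>j. twisted_hom e D (\<lambda>x. x) (E j) (E j) (\<delta> j)) \<and>
     (\<forall>j. \<forall>x\<in>carrier (E j). \<delta> (Suc j) (d j x) = d j (\<delta> j x)) \<and>
     (\<forall>r. \<delta> 0 (\<epsilon> r) = \<epsilon> (D r))"

lemma
  assumes "lift_of e D \<delta>"
  shows lift_twisted: "twisted_hom e D (\<lambda>x. x) (E j) (E j) (\<delta> j)"
    and lift_d: "x \<in> carrier (E j) \<Longrightarrow> \<delta> (Suc j) (d j x) = d j (\<delta> j x)"
    and lift_\<epsilon>: "\<delta> 0 (\<epsilon> r) = \<epsilon> (D r)"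
  using assms by (auto simp: lift_of_def)

lemma lift_closed: "lift_of e D \<delta> \<Longrightarrow> x \<in> carrier (E j) \<Longrightarrow> \<delta> j x \<in> carrier (E j)"
  using twisted_hom_closed[OF lift_twisted] .

text \<open>
  The analogue for derivations of the comparison theorem for injective resolutions. The first map
  extends \<open>\<epsilon> \<circ> D\<close> along \<open>\<epsilon>\<close>, and each later map extends \<open>d j \<circ> \<delta> j\<close> along \<open>d j\<close>. The latter is possible if
  \<open>d j \<circ> \<delta> j\<close> vanishes on the kernel of \<open>d j\<close>, and so this condition is carried along in the recursion;
  exactness gives it for the next map.
\<close>

theorem lift_exists:
  assumes D: "derivation e D" shows "\<exists>\<delta>. lift_of e D \<delta>"
proof -
  have S: "graded_mod gr cmp (shifted_ideal UNIV 0)" using graded_mod_self by (simp add: self_gmodule_eq)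
  let ?S = "shifted_ideal UNIV 0 :: ('r, 'r) gmodule"
  have \<epsilon>_mult: "\<epsilon> (r * s) = r \<odot>\<^bsub>E 0\<^esub> \<epsilon> s" for r s
    using linear_hom_smult[OF graded_mod_E linear_\<epsilon>, of s r] by simp
  have \<epsilon>_add: "\<epsilon> (r + s) = \<epsilon> r \<oplus>\<^bsub>E 0\<^esub> \<epsilon> s" for r s
    using twisted_hom_add[OF linear_\<epsilon>, of r s] by simp
  have \<epsilon>_gr: "\<epsilon> r \<in> hpart (E 0) n" if "r \<in> gr n" for r n
    using twisted_hom_hpart[OF linear_\<epsilon>, of r n] that by simp
  have start: "twisted_hom e D (\<lambda>r. \<epsilon> r) ?S (E 0) (\<lambda>r. \<epsilon> (D r))"
    using derivation_gr[OF D]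
    by (auto simp: twisted_hom_def \<epsilon>_closed \<epsilon>_add \<epsilon>_gr \<epsilon>_mult derivation_add[OF D] derivation_mult[OF D]
        mult.commute simp flip: \<epsilon>_mult)
  let ?P = "\<lambda>j f. twisted_hom e D (\<lambda>x. x) (E j) (E j) f \<and> (j = 0 \<longrightarrow> (\<forall>r. f (\<epsilon> r) = \<epsilon> (D r))) \<and>
      (\<forall>x\<in>carrier (E j). d j x = \<zero>\<^bsub>E (Suc j)\<^esub> \<longrightarrow> d j (f x) = \<zero>\<^bsub>E (Suc j)\<^esub>)"
  let ?Q = "\<lambda>j f h. \<forall>x\<in>carrier (E j). h (d j x) = d j (f x)"
  have "\<exists>\<delta>. \<forall>j. ?P j (\<delta> j) \<and> ?Q j (\<delta> j) (\<delta> (Suc j))"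
  proof (rule dependent_nat_choice)
    obtain f where f: "twisted_hom e D (\<lambda>x. x) (E 0) (E 0) f"
      "\<And>x. x \<in> carrier ?S \<Longrightarrow> f (\<epsilon> x) = \<epsilon> (D x)"
    proof (rule twisted_hom_extension_along[OF injective S graded_mod_E D linear_id linear_\<epsilon> start])
      show "\<epsilon> (D x) = \<zero>\<^bsub>E 0\<^esub>" if "\<epsilon> x = \<zero>\<^bsub>E 0\<^esub>" for x
      proof -
        have "x = 0" using that \<epsilon>_zero inj_\<epsilon> by (metis injD)
        then show ?thesis by (simp add: derivation_zero[OF D] \<epsilon>_zero)
      qed
    qed (use that in blast)
    have "d 0 (f x) = \<zero>\<^bsub>E (Suc 0)\<^esub>" if "x \<in> carrier (E 0)" "d 0 x = \<zero>\<^bsub>E (Suc 0)\<^esub>" for x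
      using that exact_0 \<epsilon>_closed f(2) by auto
    then show "\<exists>f. ?P 0 f" using f by (intro exI[of _ f]) auto
  next
    fix f j assume P: "?P j f"
    have tw: "twisted_hom e D (\<lambda>x. d j x) (E j) (E (Suc j)) (\<lambda>x. d j (f x))"
      using P twisted_hom_hpart[OF linear_d[of j]]
      by (auto simp: twisted_hom_def d_closed d_add d_smult E.smult_mem Pi_iff)
    obtain h where h: "twisted_hom e D (\<lambda>x. x) (E (Suc j)) (E (Suc j)) h"
      "\<And>x. x \<in> carrier (E j) \<Longrightarrow> h (d j x) = d j (f x)"
      by (rule twisted_hom_extension_along[OF injective graded_mod_E graded_mod_E D linear_id linear_d tw])
        (use P in auto)
    have "d (Suc j) (h x) = \<zero>\<^bsub>E (Suc (Suc j))\<^esub>"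
      if x: "x \<in> carrier (E (Suc j))" "d (Suc j) x = \<zero>\<^bsub>E (Suc (Suc j))\<^esub>" for x
    proof -
      obtain y where y: "y \<in> carrier (E j)" "x = d j y" using exact_Suc x by blast
      have "twisted_hom e D (\<lambda>x. x) (E j) (E j) f" using P by simp
      then have "f y \<in> carrier (E j)" using y(1) by (rule twisted_hom_closed)
      then show ?thesis using y h(2) d_d by simp
    qed
    then show "\<exists>h. ?P (Suc j) h \<and> ?Q j f h" using h by (intro exI[of _ h]) auto
  qed
  then obtain \<delta> where "\<forall>j. ?P j (\<delta> j) \<and> ?Q j (\<delta> j) (\<delta> (Suc j))" by (rule exE)
  then have "lift_of e D \<delta>" unfolding lift_of_def by simp
  then show ?thesis by blast
qed

lemma lift_of_plus:
  assumes \<delta>: "lift_of e D \<delta>" and \<delta>': "lift_of e D' \<delta>'"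
  shows "lift_of e (\<lambda>r. D r + D' r) (\<lambda>j x. \<delta> j x \<oplus>\<^bsub>E j\<^esub> \<delta>' j x)"
  unfolding lift_of_def
proof (intro conjI allI ballI)
  show "twisted_hom e (\<lambda>r. D r + D' r) (\<lambda>x. x) (E j) (E j) (\<lambda>x. \<delta> j x \<oplus>\<^bsub>E j\<^esub> \<delta>' j x)" for j
    by (rule twisted_hom_plus[OF graded_mod_E _ lift_twisted[OF \<delta>] lift_twisted[OF \<delta>']])
qed (use twisted_hom_add[OF linear_\<epsilon>] in
  \<open>auto simp: lift_d[OF \<delta>] lift_d[OF \<delta>'] lift_\<epsilon>[OF \<delta>] lift_\<epsilon>[OF \<delta>'] lift_closed[OF \<delta>] lift_closed[OF \<delta>'] d_add\<close>)

lemma lift_of_scale: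
  assumes \<delta>: "lift_of e D \<delta>" and s: "s \<in> gr b"
  shows "lift_of (b + e) (\<lambda>r. s * D r) (\<lambda>j x. s \<odot>\<^bsub>E j\<^esub> \<delta> j x)"
  unfolding lift_of_def
proof (intro conjI allI ballI)
  show "twisted_hom (b + e) (\<lambda>r. s * D r) (\<lambda>x. x) (E j) (E j) (\<lambda>x. s \<odot>\<^bsub>E j\<^esub> \<delta> j x)" for j
    by (rule twisted_hom_scale[OF graded_mod_E _ lift_twisted[OF \<delta>] s])
qed (use linear_hom_smult[OF graded_mod_E linear_\<epsilon>] in
  \<open>auto simp: lift_d[OF \<delta>] lift_\<epsilon>[OF \<delta>] lift_closed[OF \<delta>] d_smult\<close>)

lemma lift_of_cong:
  assumes "lift_of e D \<delta>" and "\<And>j x. x \<in> carrier (E j) \<Longrightarrow> \<delta>' j x = \<delta> j x"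
  shows "lift_of e D \<delta>'"
  using assms E.hpart_carrier d_closed \<epsilon>_closed by (auto simp: lift_of_def twisted_hom_def E.smult_mem Pi_iff)

lemma lift_of_sum:
  assumes "finite F" "\<And>k. k \<in> F \<Longrightarrow> lift_of e (D k) (\<delta> k)"
  shows "lift_of e (\<lambda>r. \<Sum>k\<in>F. D k r) (\<lambda>j x. \<Oplus>\<^bsub>E j\<^esub>k\<in>F. \<delta> k j x)"
  using assms
proof (induction F rule: finite_induct)
  case empty
  then show ?case
    by (auto simp: lift_of_def d_zero \<epsilon>_zero intro!: twisted_hom_null[OF graded_mod_E])
next
  case (insert k F)
  then have *: "lift_of e (\<lambda>r. D k r + (\<Sum>k\<in>F. D k r))
      (\<lambda>j x. \<delta> k j x \<oplus>\<^bsub>E j\<^esub> (\<Oplus>\<^bsub>E j\<^esub>k\<in>F. \<delta> k j x))"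
    by (intro lift_of_plus) auto
  have c: "\<delta> l j x \<in> carrier (E j)" if "l \<in> insert k F" "x \<in> carrier (E j)" for l j x
    using lift_closed[OF insert.prems[OF that(1)] that(2)] .
  have "lift_of e (\<lambda>r. D k r + (\<Sum>k\<in>F. D k r)) (\<lambda>j x. \<Oplus>\<^bsub>E j\<^esub>k\<in>insert k F. \<delta> k j x)"
    using * by (rule lift_of_cong) (use insert.hyps c in \<open>auto intro!: E.finsum_insert\<close>)
  then show ?case using insert.hyps by simp
qed

text \<open>
  The degree operator commutes with all homogeneous maps of degree \<open>0\<close>, and so it lifts the Euler
  derivation without any choice.
\<close>

lemma lift_of_degree_op:
  assumes Eu: "derivation 0 Eu" and Euler: "\<And>a r. r \<in> gr a \<Longrightarrow> Eu r = of_int a * r"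
  shows "lift_of 0 Eu (\<lambda>j. degree_op (E j))"
proof -
  have "degree_op (E 0) (\<epsilon> r) = \<epsilon> (Eu r)" for r
  proof (induction r rule: homogeneous_ring_induct)
    case (1 a r)
    then have "\<epsilon> r \<in> hpart (E 0) a" using twisted_hom_hpart[OF linear_\<epsilon>, of r a] by simp
    from degree_op_homogeneous[OF graded_mod_E this] show ?case
      using linear_hom_smult[OF graded_mod_E linear_\<epsilon>, of r "of_int a"] by (simp add: Euler[OF 1])
  next
    case (2 r s)
    then show ?case
      using twisted_hom_add[OF linear_\<epsilon>] by (simp add: degree_op_add[OF graded_mod_E] \<epsilon>_closed derivation_add[OF Eu])
  qed
  then show ?thesis
    unfolding lift_of_def
    by (simp add: twisted_hom_degree_op[OF graded_mod_E Eu Euler]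
        degree_op_natural[OF graded_mod_E graded_mod_E linear_d])
qed

text \<open>
  The lifts of a derivation of degree \<open>0\<close> are unique up to a linear homotopy: the difference of two of them lifts
  the derivation \<open>0\<close> and is linear. With \<open>h\<close> constructed up to some stage, \<open>\<theta> - d h\<close> vanishes on the
  kernel of the next differential, hence factors through it, which gives the next \<open>h\<close>. The induction
  needs from the homotopy formula only its restriction to cocycles, which is the formula stated here.
\<close>

theorem null_homotopic:
  assumes \<theta>: "lift_of 0 (\<lambda>_. 0) \<theta>"
  shows "\<exists>h. linear_hom (E (Suc j)) (E j) h \<and>
    (\<forall>x\<in>carrier (E (Suc j)). d (Suc j) x = \<zero>\<^bsub>E (Suc (Suc j))\<^esub> \<longrightarrow> \<theta> (Suc j) x = d j (h x))"
proof (induction j)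
  have lin: "linear_hom (E j) (E j) (\<theta> j)" for j
    by (rule twisted_hom_cong_twist[OF graded_mod_E _ _ lift_twisted[OF \<theta>]]) auto
  have zc: "linear_hom (E (Suc j)) (E j) (\<lambda>_. \<zero>\<^bsub>E j\<^esub>)" for j
    by (rule twisted_hom_null[OF graded_mod_E]) auto
  {
    case 0
    have "\<theta> 0 x = \<zero>\<^bsub>E 0\<^esub>" if "x \<in> carrier (E 0)" "d 0 x = \<zero>\<^bsub>E (Suc 0)\<^esub>" for x
      using that exact_0 lift_\<epsilon>[OF \<theta>] \<epsilon>_zero by auto
    then obtain h where h: "linear_hom (E (Suc 0)) (E 0) h" "\<And>x. x \<in> carrier (E 0) \<Longrightarrow> h (d 0 x) = \<theta> 0 x"
      using twisted_hom_extension_along[OF injective graded_mod_E graded_mod_E derivation_null zc linear_d lin]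
      by metis
    have "\<theta> (Suc 0) x = d 0 (h x)" if "x \<in> carrier (E (Suc 0))" "d (Suc 0) x = \<zero>\<^bsub>E (Suc (Suc 0))\<^esub>" for x
      using that exact_Suc[of x 0] lift_d[OF \<theta>] h(2) by auto
    then show ?case using h(1) by blast
  next
    case (Suc j)
    then obtain h where h: "linear_hom (E (Suc j)) (E j) h"
      "\<And>x. x \<in> carrier (E (Suc j)) \<Longrightarrow> d (Suc j) x = \<zero>\<^bsub>E (Suc (Suc j))\<^esub> \<Longrightarrow> \<theta> (Suc j) x = d j (h x)"
      by blast
    let ?\<phi> = "\<lambda>x. \<theta> (Suc j) x \<oplus>\<^bsub>E (Suc j)\<^esub> (-1) \<odot>\<^bsub>E (Suc j)\<^esub> d j (h x)"
    have hc: "h x \<in> carrier (E j)" if "x \<in> carrier (E (Suc j))" for x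
      using twisted_hom_closed[OF h(1) that] .
    have \<theta>c: "\<theta> k x \<in> carrier (E k)" if "x \<in> carrier (E k)" for k x using lift_closed[OF \<theta> that] .
    have "twisted_hom (0 + 0) (\<lambda>_. (-1) * 0) (\<lambda>_. \<zero>\<^bsub>E (Suc j)\<^esub>) (E (Suc j)) (E (Suc j))
        (\<lambda>x. (-1) \<odot>\<^bsub>E (Suc j)\<^esub> d j (h x))"
      by (rule twisted_hom_scale[OF graded_mod_E _ linear_hom_comp[OF graded_mod_E graded_mod_E h(1) linear_d]
            uminus_gr[OF one_gr]]) simp
    then have "linear_hom (E (Suc j)) (E (Suc j)) (\<lambda>x. (-1) \<odot>\<^bsub>E (Suc j)\<^esub> d j (h x))" by simp
    from twisted_hom_plus[OF graded_mod_E _ lin this]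
    have \<phi>: "linear_hom (E (Suc j)) (E (Suc j)) ?\<phi>" by simp
    have "?\<phi> x = \<zero>\<^bsub>E (Suc j)\<^esub>" if "x \<in> carrier (E (Suc j))" "d (Suc j) x = \<zero>\<^bsub>E (Suc (Suc j))\<^esub>" for x
      using that h(2) hc by (simp add: E.add_uminus d_closed)
    then obtain h' where h': "linear_hom (E (Suc (Suc j))) (E (Suc j)) h'"
      "\<And>x. x \<in> carrier (E (Suc j)) \<Longrightarrow> h' (d (Suc j) x) = ?\<phi> x"
      using twisted_hom_extension_along[OF injective graded_mod_E graded_mod_E derivation_null zc linear_d \<phi>]
      by metis
    have "\<theta> (Suc (Suc j)) x = d (Suc j) (h' x)"
      if x: "x \<in> carrier (E (Suc (Suc j)))" "d (Suc (Suc j)) x = \<zero>\<^bsub>E (Suc (Suc (Suc j)))\<^esub>" for x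
    proof -
      obtain y where y: "y \<in> carrier (E (Suc j))" "x = d (Suc j) y" using exact_Suc x by blast
      have "d (Suc j) (?\<phi> y) = d (Suc j) (\<theta> (Suc j) y)"
        using y(1) hc \<theta>c by (simp add: d_add d_smult E.smult_mem d_closed d_d E.smult_zero)
      then show ?thesis using y h'(2) lift_d[OF \<theta>] by simp
    qed
    then show ?case using h'(1) by blast
  }
qed

end

section \<open>Ideal powers and derivations\<close>

lemma ring_class: "ring (cring_class_ops :: 'r::comm_ring_1 ring)"
  by (rule cring.axioms(1)[OF cring_class])

lemma ideal_class_closed:
  fixes J :: "'r::comm_ring_1 set"
  assumes "ideal J (cring_class_ops :: 'r ring)"
  shows ideal_class_add: "r \<in> J \<Longrightarrow> s \<in> J \<Longrightarrow> r + s \<in> J"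
    and ideal_class_mult: "s \<in> J \<Longrightarrow> r * s \<in> J"
  using ideal.axioms(1)[OF assms] additive_subgroup.a_closed
    ideal.I_l_closed[OF assms, of s r]
  by (fastforce simp: class_simps)+

lemma ideal_ideal_power:
  fixes I :: "'r::comm_ring_1 set"
  assumes "ideal I (cring_class_ops :: 'r ring)"
  shows "ideal (ideal_power cring_class_ops I k) cring_class_ops"
  by (induction k) (auto intro: ring.oneideal[OF ring_class] ring.ideal_prod_is_ideal[OF ring_class] assms)

lemma ideal_power_antimono:
  fixes I :: "'r::comm_ring_1 set"
  assumes I: "ideal I (cring_class_ops :: 'r ring)" and "k \<le> l"
  shows "ideal_power cring_class_ops I l \<subseteq> ideal_power cring_class_ops I k"
  using \<open>k \<le> l\<close>
proof (induction rule: dec_induct)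
  case (step l)
  have "ideal_power cring_class_ops I (Suc l) \<subseteq> ideal_power cring_class_ops I l"
    using ring.ideal_prod_inter[OF ring_class I ideal_ideal_power[OF I]] by auto
  then show ?case using step.IH by blast
qed simp

context graded_comm_ring
begin

text \<open>
  A derivation lowers the exponent of an ideal power by at most one, since the Leibniz rule
  differentiates one factor of a product at a time.
\<close>

lemma derivation_ideal_power:
  assumes D: "derivation e D" and I: "ideal I cring_class_ops"
  shows "a \<in> ideal_power cring_class_ops I (Suc k) \<Longrightarrow> D a \<in> ideal_power cring_class_ops I k"
proof (induction k arbitrary: a)
  case 0
  then show ?case by (simp add: carrier_class)
next
  case (Suc k)
  note J = ideal_ideal_power[OF I, of "Suc k"]
  from Suc.prems have "a \<in> I \<cdot>\<^bsub>cring_class_ops\<^esub> ideal_power cring_class_ops I (Suc k)" by simp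
  then show ?case
  proof (induction rule: ideal_prod.induct)
    case (prod i j)
    have "i * D j \<in> ideal_power cring_class_ops I (Suc k)"
      using ideal_prod.prod[OF prod(1) Suc.IH[OF prod(2)], of cring_class_ops] by (simp add: times_class)
    then show ?case
      using ideal_class_mult[OF J prod(2), of "D i"] ideal_class_add[OF J]
      by (simp add: times_class derivation_mult[OF D] mult.commute del: ideal_power.simps)
  next
    case (sum a b)
    then show ?case
      using ideal_class_add[OF J] by (simp add: plus_class derivation_add[OF D] del: ideal_power.simps)
  qed
qed

end

section \<open>The action on local cohomology\<close>

locale local_cohomology_resolution = graded_resolution gr cmp E \<epsilon> d
  for gr :: "int \<Rightarrow> 'r::comm_ring_1 set" and cmp :: "'r \<Rightarrow> int \<Rightarrow> 'r"
    and E :: "nat \<Rightarrow> ('r, 'e) gmodule" and \<epsilon> :: "'r \<Rightarrow> 'e" and d :: "nat \<Rightarrow> 'e \<Rightarrow> 'e" +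
  fixes I :: "'r set"
  assumes ideal_I: "ideal I cring_class_ops"
begin

abbreviation torsion :: "nat \<Rightarrow> 'e set" where
  "torsion j \<equiv> torsion_part cring_class_ops I (E j)"

abbreviation cocycles :: "nat \<Rightarrow> 'e set" where
  "cocycles \<equiv> lc_cocycles cring_class_ops I E d"

abbreviation coboundaries :: "nat \<Rightarrow> 'e set" where
  "coboundaries \<equiv> lc_coboundaries cring_class_ops I E d"

text \<open>
  Since ideal powers decrease, an exponent that annihilates may be replaced by any larger one, so
  two elements have a common one.
\<close>

lemma torsionE:
  assumes "x \<in> torsion j"
  obtains k where "x \<in> carrier (E j)"
    "\<forall>l\<ge>k. \<forall>a \<in> ideal_power cring_class_ops I l. a \<odot>\<^bsub>E j\<^esub> x = \<zero>\<^bsub>E j\<^esub>"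
  using assms ideal_power_antimono[OF ideal_I] unfolding torsion_part_def by blast

lemma torsionI:
  assumes "x \<in> carrier (E j)" "\<And>a. a \<in> ideal_power cring_class_ops I k \<Longrightarrow> a \<odot>\<^bsub>E j\<^esub> x = \<zero>\<^bsub>E j\<^esub>"
  shows "x \<in> torsion j"
  using assms unfolding torsion_part_def by blast

lemma torsion_carrier: "x \<in> torsion j \<Longrightarrow> x \<in> carrier (E j)"
  by (simp add: torsion_part_def)

lemma torsion_add:
  assumes x: "x \<in> torsion j" and y: "y \<in> torsion j" shows "x \<oplus>\<^bsub>E j\<^esub> y \<in> torsion j"
proof -
  obtain k where k: "x \<in> carrier (E j)"
    "\<forall>l\<ge>k. \<forall>a \<in> ideal_power cring_class_ops I l. a \<odot>\<^bsub>E j\<^esub> x = \<zero>\<^bsub>E j\<^esub>"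
    by (rule torsionE[OF x])
  obtain k' where k': "y \<in> carrier (E j)"
    "\<forall>l\<ge>k'. \<forall>a \<in> ideal_power cring_class_ops I l. a \<odot>\<^bsub>E j\<^esub> y = \<zero>\<^bsub>E j\<^esub>"
    by (rule torsionE[OF y])
  show ?thesis
    by (rule torsionI[where k = "max k k'"])
      (simp_all add: E.smult_add_right k(1) k'(1) k(2)[rule_format, of "max k k'"] k'(2)[rule_format, of "max k k'"])
qed

lemma torsion_linear:
  assumes f: "linear_hom (E i) (E j) f" and x: "x \<in> torsion i" shows "f x \<in> torsion j"
proof -
  obtain k where k: "x \<in> carrier (E i)"
    "\<forall>l\<ge>k. \<forall>a \<in> ideal_power cring_class_ops I l. a \<odot>\<^bsub>E i\<^esub> x = \<zero>\<^bsub>E i\<^esub>"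
    by (rule torsionE[OF x])
  show ?thesis
  proof (rule torsionI[where k = k])
    show "f x \<in> carrier (E j)" using twisted_hom_closed[OF f k(1)] .
    show "a \<odot>\<^bsub>E j\<^esub> f x = \<zero>\<^bsub>E j\<^esub>" if "a \<in> ideal_power cring_class_ops I k" for a
      using linear_hom_smult[OF graded_mod_E f k(1), of a, symmetric] k(2)[rule_format, OF _ that]
        twisted_hom_zero[OF graded_mod_E graded_mod_E f] by simp
  qed
qed

lemma torsion_smult:
  assumes "x \<in> torsion j" shows "r \<odot>\<^bsub>E j\<^esub> x \<in> torsion j"
proof -
  obtain k where k: "x \<in> carrier (E j)"
    "\<forall>l\<ge>k. \<forall>a \<in> ideal_power cring_class_ops I l. a \<odot>\<^bsub>E j\<^esub> x = \<zero>\<^bsub>E j\<^esub>"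
    by (rule torsionE[OF assms])
  show ?thesis
    by (rule torsionI[where k = k])
      (use k ideal_class_mult[OF ideal_ideal_power[OF ideal_I], of _ k r] in
        \<open>auto simp: E.smult_mem mult.commute simp flip: E.smult_mult\<close>)
qed

text \<open>
  If \<open>a\<close> lies in the power with exponent \<open>k + 1\<close>, then both \<open>a\<close> and \<open>D a\<close> lie in the power with
  exponent \<open>k\<close>, and the Leibniz rule \<open>a \<delta> x = \<delta> (a x) - D a x\<close> shows that \<open>a\<close> kills \<open>\<delta> x\<close>.
\<close>

lemma torsion_lift:
  assumes D: "derivation e D" and \<delta>: "lift_of e D \<delta>" and x: "x \<in> torsion j"
  shows "\<delta> j x \<in> torsion j"
proof -
  obtain k where k: "x \<in> carrier (E j)"
    "\<forall>l\<ge>k. \<forall>a \<in> ideal_power cring_class_ops I l. a \<odot>\<^bsub>E j\<^esub> x = \<zero>\<^bsub>E j\<^esub>"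
    by (rule torsionE[OF x])
  have c: "\<delta> j x \<in> carrier (E j)" using lift_closed[OF \<delta> k(1)] .
  have "a \<odot>\<^bsub>E j\<^esub> \<delta> j x = \<zero>\<^bsub>E j\<^esub>" if a: "a \<in> ideal_power cring_class_ops I (Suc k)" for a
  proof -
    have "\<delta> j (a \<odot>\<^bsub>E j\<^esub> x) = a \<odot>\<^bsub>E j\<^esub> \<delta> j x \<oplus>\<^bsub>E j\<^esub> D a \<odot>\<^bsub>E j\<^esub> x"
      by (rule twisted_hom_smult[OF lift_twisted[OF \<delta>] k(1)])
    moreover have "a \<odot>\<^bsub>E j\<^esub> x = \<zero>\<^bsub>E j\<^esub>" using k(2)[rule_format, OF _ a] by simp
    moreover have "D a \<odot>\<^bsub>E j\<^esub> x = \<zero>\<^bsub>E j\<^esub>"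
      using k(2)[rule_format, OF _ derivation_ideal_power[OF D ideal_I a]] by simp
    moreover have "\<delta> j \<zero>\<^bsub>E j\<^esub> = \<zero>\<^bsub>E j\<^esub>"
      by (rule twisted_hom_zero[OF graded_mod_E graded_mod_E lift_twisted[OF \<delta>]])
    ultimately show ?thesis using c by (simp add: E.smult_mem)
  qed
  with c show ?thesis by (rule torsionI)
qed

lemma zero_torsion: "\<zero>\<^bsub>E j\<^esub> \<in> torsion j"
  by (rule torsionI[where k = 0]) (simp_all add: E.smult_zero)

lemma cocycles_iff: "z \<in> cocycles i \<longleftrightarrow> z \<in> torsion i \<and> d i z = \<zero>\<^bsub>E (Suc i)\<^esub>"
  by (auto simp: lc_cocycles_def a_kernel_iff torsion_carrier)

lemma cocycles_carrier: "z \<in> cocycles i \<Longrightarrow> z \<in> carrier (E i)"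
  by (simp add: cocycles_iff torsion_carrier)

lemma cocycles_smult: "z \<in> cocycles i \<Longrightarrow> r \<odot>\<^bsub>E i\<^esub> z \<in> cocycles i"
  by (simp add: cocycles_iff torsion_smult d_smult torsion_carrier E.smult_zero)

lemma cocycles_lift:
  assumes D: "derivation e D" and \<delta>: "lift_of e D \<delta>" and z: "z \<in> cocycles i"
  shows "\<delta> i z \<in> cocycles i"
  using z torsion_lift[OF D \<delta>] lift_d[OF \<delta>, of z i, symmetric] torsion_carrier[of z i]
    twisted_hom_zero[OF graded_mod_E graded_mod_E lift_twisted[OF \<delta>], of "Suc i"]
  by (simp add: cocycles_iff)

lemma coboundaries_carrier: "b \<in> coboundaries i \<Longrightarrow> b \<in> carrier (E i)"
  by (cases i) (auto simp: torsion_carrier d_closed)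

lemma coboundaries_zero: "\<zero>\<^bsub>E i\<^esub> \<in> coboundaries i"
  by (cases i) (auto simp: image_iff intro!: bexI[OF _ zero_torsion] d_zero[symmetric])

lemma coboundaries_add: "b \<in> coboundaries i \<Longrightarrow> c \<in> coboundaries i \<Longrightarrow> b \<oplus>\<^bsub>E i\<^esub> c \<in> coboundaries i"
  by (cases i) (auto simp: d_add[symmetric] torsion_carrier torsion_add)

lemma coboundaries_smult: "b \<in> coboundaries i \<Longrightarrow> r \<odot>\<^bsub>E i\<^esub> b \<in> coboundaries i"
  by (cases i) (auto simp: d_smult[symmetric] torsion_carrier torsion_smult E.smult_zero)

lemma coboundaries_lift:
  assumes D: "derivation e D" and \<delta>: "lift_of e D \<delta>" and b: "b \<in> coboundaries i"
  shows "\<delta> i b \<in> coboundaries i"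
proof (cases i)
  case 0
  then show ?thesis
    using b twisted_hom_zero[OF graded_mod_E graded_mod_E lift_twisted[OF \<delta>], of 0] by simp
next
  case (Suc j)
  then show ?thesis
    using b torsion_lift[OF D \<delta>] lift_d[OF \<delta>] torsion_carrier by auto
qed

lemma coboundaries_finsum:
  assumes "finite F" "\<And>k. k \<in> F \<Longrightarrow> b k \<in> coboundaries i"
  shows "(\<Oplus>\<^bsub>E i\<^esub>k\<in>F. b k) \<in> coboundaries i"
  using assms
proof (induction F rule: finite_induct)
  case (insert k F)
  have "(\<Oplus>\<^bsub>E i\<^esub>k\<in>insert k F. b k) = b k \<oplus>\<^bsub>E i\<^esub> (\<Oplus>\<^bsub>E i\<^esub>k\<in>F. b k)"
    using insert by (intro E.finsum_insert) (auto intro: coboundaries_carrier)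
  then show ?case using insert by (simp add: coboundaries_add)
qed (simp add: coboundaries_zero)

text \<open>
  On a cocycle, a chain map that lifts \<open>0\<close> is \<open>d h\<close> for a linear \<open>h\<close>, and linear maps preserve
  torsion. In cohomological degree \<open>0\<close> a cocycle comes from the ring, where the map is \<open>0\<close>.
\<close>

lemma null_lift_coboundary:
  assumes \<theta>: "lift_of 0 (\<lambda>_. 0) \<theta>" and z: "z \<in> cocycles i"
  shows "\<theta> i z \<in> coboundaries i"
proof (cases i)
  case 0
  have "z \<in> range \<epsilon>" using z exact_0[of z] by (simp add: 0 cocycles_iff torsion_carrier)
  then show ?thesis using lift_\<epsilon>[OF \<theta>] by (auto simp: 0 \<epsilon>_zero)
next
  case (Suc j)
  then show ?thesis
    using null_homotopic[OF \<theta>, of j] z torsion_linear torsion_carrier by (fastforce simp: cocycles_iff)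
qed

text \<open>
  Both \<open>\<Sum>k. \<xi> k \<cdot> \<delta> k\<close> and the degree operator lift the Euler derivation \<open>\<Sum>k. \<xi> k \<cdot> D k\<close>, so they agree on
  cohomology. Hence the Euler operator acts as multiplication by \<open>n\<close> on classes of degree \<open>n\<close>.
\<close>

lemma euler_cohomology:
  fixes \<xi> :: "'k::finite \<Rightarrow> 'r" and D :: "'k \<Rightarrow> 'r \<Rightarrow> 'r"
  assumes \<xi>: "\<And>k. \<xi> k \<in> gr 1" and D: "\<And>k. derivation (-1) (D k)"
    and euler: "\<And>a r. r \<in> gr a \<Longrightarrow> (\<Sum>k\<in>UNIV. \<xi> k * D k r) = of_int a * r"
    and \<delta>: "\<And>k. lift_of (-1) (D k) (\<delta> k)"
    and z: "z \<in> cocycles i" "z \<in> hpart (E i) n"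
  shows "\<exists>b\<in>coboundaries i. (\<Oplus>\<^bsub>E i\<^esub>k\<in>UNIV. \<xi> k \<odot>\<^bsub>E i\<^esub> \<delta> k i z) = b \<oplus>\<^bsub>E i\<^esub> of_int n \<odot>\<^bsub>E i\<^esub> z"
proof -
  define Eu where "Eu r = (\<Sum>k\<in>UNIV. \<xi> k * D k r)" for r
  have "derivation (1 + (-1)) (\<lambda>r. \<xi> k * D k r)" for k by (rule derivation_scale[OF D \<xi>])
  then have Eu: "derivation 0 Eu" unfolding Eu_def by (intro derivation_sum) auto
  have "lift_of (1 + (-1)) (\<lambda>r. \<xi> k * D k r) (\<lambda>j x. \<xi> k \<odot>\<^bsub>E j\<^esub> \<delta> k j x)" for k
    by (rule lift_of_scale[OF \<delta> \<xi>])
  then have "lift_of 0 Eu (\<lambda>j x. \<Oplus>\<^bsub>E j\<^esub>k\<in>UNIV. \<xi> k \<odot>\<^bsub>E j\<^esub> \<delta> k j x)"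
    unfolding Eu_def by (intro lift_of_sum) auto
  moreover have deg: "lift_of 0 Eu (\<lambda>j. degree_op (E j))"
    by (rule lift_of_degree_op[OF Eu]) (simp add: Eu_def euler)
  have "lift_of (0 + 0) (\<lambda>r. (-1) * Eu r) (\<lambda>j x. (-1) \<odot>\<^bsub>E j\<^esub> degree_op (E j) x)"
    by (rule lift_of_scale[OF deg uminus_gr[OF one_gr]])
  ultimately have "lift_of 0 (\<lambda>r. Eu r + (-1) * Eu r)
     (\<lambda>j x. (\<Oplus>\<^bsub>E j\<^esub>k\<in>UNIV. \<xi> k \<odot>\<^bsub>E j\<^esub> \<delta> k j x) \<oplus>\<^bsub>E j\<^esub> (-1) \<odot>\<^bsub>E j\<^esub> degree_op (E j) x)"
    by (intro lift_of_plus) auto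
  then have "lift_of 0 (\<lambda>_. 0)
     (\<lambda>j x. (\<Oplus>\<^bsub>E j\<^esub>k\<in>UNIV. \<xi> k \<odot>\<^bsub>E j\<^esub> \<delta> k j x) \<oplus>\<^bsub>E j\<^esub> (-1) \<odot>\<^bsub>E j\<^esub> degree_op (E j) x)" by simp
  from null_lift_coboundary[OF this z(1)]
  have b: "(\<Oplus>\<^bsub>E i\<^esub>k\<in>UNIV. \<xi> k \<odot>\<^bsub>E i\<^esub> \<delta> k i z) \<oplus>\<^bsub>E i\<^esub> (-1) \<odot>\<^bsub>E i\<^esub> (of_int n \<odot>\<^bsub>E i\<^esub> z) \<in> coboundaries i"
    by (simp add: degree_op_homogeneous[OF graded_mod_E z(2)])
  have zc: "z \<in> carrier (E i)" using z(1) by (rule cocycles_carrier)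
  have "(\<Oplus>\<^bsub>E i\<^esub>k\<in>UNIV. \<xi> k \<odot>\<^bsub>E i\<^esub> \<delta> k i z) \<in> carrier (E i)"
    using lift_closed[OF \<delta> zc] by (auto simp: E.smult_mem intro!: E.finsum_closed)
  moreover have "of_int n \<odot>\<^bsub>E i\<^esub> z \<in> carrier (E i)" using zc by (rule E.smult_mem)
  moreover have "(s \<oplus>\<^bsub>E i\<^esub> (-1) \<odot>\<^bsub>E i\<^esub> y) \<oplus>\<^bsub>E i\<^esub> y = s" if "s \<in> carrier (E i)" "y \<in> carrier (E i)" for s y
    using that E.add_uminus[of y] by (metis E.a_assoc E.a_comm E.r_zero E.smult_mem)
  ultimately show ?thesis using b by (intro bexI[OF _ b]) simp
qed

lemma cancel_unit_coboundary:
  assumes z: "z \<in> carrier (E i)" and u: "u * r = 1" and rz: "r \<odot>\<^bsub>E i\<^esub> z \<in> coboundaries i"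
  shows "z \<in> coboundaries i"
  using coboundaries_smult[OF rz, of u] z u by (simp add: E.smult_mult[symmetric] E.smult_1)

lemma coboundaries_cancel_left:
  assumes "b \<in> coboundaries i" "b \<oplus>\<^bsub>E i\<^esub> y \<in> coboundaries i" "y \<in> carrier (E i)"
  shows "y \<in> coboundaries i"
proof -
  have "(-1) \<odot>\<^bsub>E i\<^esub> b \<oplus>\<^bsub>E i\<^esub> (b \<oplus>\<^bsub>E i\<^esub> y) = y"
    using coboundaries_carrier[OF assms(1)] assms(3) E.add_uminus[of b i]
    by (metis E.a_assoc E.a_comm E.l_zero E.smult_mem)
  then show ?thesis using coboundaries_add[OF coboundaries_smult[OF assms(1)] assms(2)] by metis
qed

text \<open>
  If the class of \<open>z\<close> is nonzero but every \<open>\<delta> k z\<close> is a coboundary, then so is \<open>n \<cdot> z\<close>, as the Euler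
  operator acts as \<open>n\<close>; this forces \<open>n = 0\<close>. If every \<open>\<xi> k \<cdot> z\<close> is a coboundary, then so is
  \<open>\<Sum>k. \<delta> k (\<xi> k \<cdot> z)\<close>. As \<open>D k (\<xi> k) = 1\<close>, this is the Euler operator plus one copy of \<open>z\<close> for each
  \<open>k\<close>, so it acts as \<open>n\<close> plus the number of variables, which must therefore be zero.
\<close>

lemma degree_steps:
  fixes \<xi> :: "'k::finite \<Rightarrow> 'r" and D :: "'k \<Rightarrow> 'r \<Rightarrow> 'r"
  assumes \<xi>: "\<And>k. \<xi> k \<in> gr 1" and D: "\<And>k. derivation (-1) (D k)" and DX: "\<And>k. D k (\<xi> k) = 1"
    and euler: "\<And>a r. r \<in> gr a \<Longrightarrow> (\<Sum>k\<in>UNIV. \<xi> k * D k r) = of_int a * r"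
    and unit: "\<And>n::int. n \<noteq> 0 \<Longrightarrow> \<exists>u. u * of_int n = (1 :: 'r)"
    and z: "z \<in> cocycles i" "z \<in> hpart (E i) n" "z \<notin> coboundaries i"
  shows degree_step_up: "n \<noteq> - int CARD('k) \<Longrightarrow> \<exists>w \<in> cocycles i \<inter> hpart (E i) (n + 1). w \<notin> coboundaries i"
    and degree_step_down: "n \<noteq> 0 \<Longrightarrow> \<exists>w \<in> cocycles i \<inter> hpart (E i) (n - 1). w \<notin> coboundaries i"
proof -
  obtain \<delta> where \<delta>: "\<And>k. lift_of (-1) (D k) (\<delta> k)" using lift_exists[OF D] by metis
  have zc: "z \<in> carrier (E i)" using z(1) by (rule cocycles_carrier)
  have \<delta>c: "\<delta> k i x \<in> carrier (E i)" if "x \<in> carrier (E i)" for k x using lift_closed[OF \<delta> that] .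
  obtain b where b: "b \<in> coboundaries i"
    "(\<Oplus>\<^bsub>E i\<^esub>k\<in>UNIV. \<xi> k \<odot>\<^bsub>E i\<^esub> \<delta> k i z) = b \<oplus>\<^bsub>E i\<^esub> of_int n \<odot>\<^bsub>E i\<^esub> z"
    using euler_cohomology[OF \<xi> D euler \<delta> z(1,2)] by blast
  have not_mult: "of_int k \<odot>\<^bsub>E i\<^esub> z \<notin> coboundaries i" if "k \<noteq> 0" for k :: int
    using unit[OF that] cancel_unit_coboundary[OF zc] z(3) by blast
  show "\<exists>w \<in> cocycles i \<inter> hpart (E i) (n - 1). w \<notin> coboundaries i" if "n \<noteq> 0"
  proof (rule ccontr)
    assume none: "\<not> ?thesis"
    have "\<delta> k i z \<in> coboundaries i" for k
      using none cocycles_lift[OF D \<delta> z(1)] twisted_hom_hpart[OF lift_twisted[OF \<delta>] z(2)] by auto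
    then have "(\<Oplus>\<^bsub>E i\<^esub>k\<in>UNIV. \<xi> k \<odot>\<^bsub>E i\<^esub> \<delta> k i z) \<in> coboundaries i"
      by (intro coboundaries_finsum coboundaries_smult) auto
    then have "of_int n \<odot>\<^bsub>E i\<^esub> z \<in> coboundaries i"
      unfolding b(2) by (rule coboundaries_cancel_left[OF b(1)]) (rule E.smult_mem[OF zc])
    then show False using not_mult[OF that] by blast
  qed
  show "\<exists>w \<in> cocycles i \<inter> hpart (E i) (n + 1). w \<notin> coboundaries i" if "n \<noteq> - int CARD('k)"
  proof (rule ccontr)
    assume none: "\<not> ?thesis"
    have "\<xi> k \<odot>\<^bsub>E i\<^esub> z \<in> coboundaries i" for k
      using none cocycles_smult[OF z(1)] E.hpart_smult[OF \<xi> z(2)] by (auto simp: add.commute)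
    then have "\<delta> k i (\<xi> k \<odot>\<^bsub>E i\<^esub> z) \<in> coboundaries i" for k by (rule coboundaries_lift[OF D \<delta>])
    then have "(\<Oplus>\<^bsub>E i\<^esub>k\<in>UNIV. \<delta> k i (\<xi> k \<odot>\<^bsub>E i\<^esub> z)) \<in> coboundaries i"
      by (intro coboundaries_finsum) auto
    also have "(\<Oplus>\<^bsub>E i\<^esub>k\<in>UNIV. \<delta> k i (\<xi> k \<odot>\<^bsub>E i\<^esub> z)) = (\<Oplus>\<^bsub>E i\<^esub>k\<in>UNIV. \<xi> k \<odot>\<^bsub>E i\<^esub> \<delta> k i z \<oplus>\<^bsub>E i\<^esub> z)"
      using zc by (simp add: twisted_hom_smult[OF lift_twisted[OF \<delta>] zc] DX E.smult_1)
    also have "\<dots> = (\<Oplus>\<^bsub>E i\<^esub>k\<in>UNIV. \<xi> k \<odot>\<^bsub>E i\<^esub> \<delta> k i z) \<oplus>\<^bsub>E i\<^esub> (\<Oplus>\<^bsub>E i\<^esub>k\<in>(UNIV :: 'k set). z)"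
      using zc \<delta>c by (intro E.finsum_addf) (auto simp: E.smult_mem)
    also have "(\<Oplus>\<^bsub>E i\<^esub>k\<in>(UNIV :: 'k set). z) = of_int (int CARD('k)) \<odot>\<^bsub>E i\<^esub> z"
    proof -
      have "(\<Oplus>\<^bsub>E i\<^esub>k\<in>F. z) = of_nat (card F) \<odot>\<^bsub>E i\<^esub> z" if "finite F" for F :: "'k set"
        using that zc by induction (simp_all add: E.smult_0 E.smult_add_left E.smult_1 E.smult_mem)
      then show ?thesis by simp
    qed
    also have "(\<Oplus>\<^bsub>E i\<^esub>k\<in>UNIV. \<xi> k \<odot>\<^bsub>E i\<^esub> \<delta> k i z) \<oplus>\<^bsub>E i\<^esub> of_int (int CARD('k)) \<odot>\<^bsub>E i\<^esub> z
        = b \<oplus>\<^bsub>E i\<^esub> of_int (n + int CARD('k)) \<odot>\<^bsub>E i\<^esub> z"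
      unfolding b(2) using zc coboundaries_carrier[OF b(1)]
      by (simp add: E.a_assoc E.smult_mem E.smult_add_left)
    finally have "of_int (n + int CARD('k)) \<odot>\<^bsub>E i\<^esub> z \<in> coboundaries i"
      by (rule coboundaries_cancel_left[OF b(1)]) (rule E.smult_mem[OF zc])
    then show False using not_mult[of "n + int CARD('k)"] that by simp
  qed
qed

lemma coset_coboundaries_iff:
  assumes z: "z \<in> carrier (E i)"
  shows "coboundaries i +>\<^bsub>E i\<^esub> z = coboundaries i \<longleftrightarrow> z \<in> coboundaries i"
proof
  assume "coboundaries i +>\<^bsub>E i\<^esub> z = coboundaries i"
  moreover have "\<zero>\<^bsub>E i\<^esub> \<oplus>\<^bsub>E i\<^esub> z \<in> coboundaries i +>\<^bsub>E i\<^esub> z"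
    using coboundaries_zero unfolding a_r_coset_def r_coset_def by auto
  ultimately show "z \<in> coboundaries i" using z by simp
next
  assume zB: "z \<in> coboundaries i"
  show "coboundaries i +>\<^bsub>E i\<^esub> z = coboundaries i"
  proof
    show "coboundaries i +>\<^bsub>E i\<^esub> z \<subseteq> coboundaries i"
      using coboundaries_add zB unfolding a_r_coset_def r_coset_def by auto
    show "coboundaries i \<subseteq> coboundaries i +>\<^bsub>E i\<^esub> z"
    proof
      fix b assume b: "b \<in> coboundaries i"
      have "(b \<oplus>\<^bsub>E i\<^esub> (-1) \<odot>\<^bsub>E i\<^esub> z) \<oplus>\<^bsub>E i\<^esub> z = b"
        using z coboundaries_carrier[OF b] E.add_uminus[of z] by (metis E.a_assoc E.a_comm E.r_zero E.smult_mem)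
      moreover have "b \<oplus>\<^bsub>E i\<^esub> (-1) \<odot>\<^bsub>E i\<^esub> z \<in> coboundaries i"
        using b zB by (intro coboundaries_add coboundaries_smult)
      ultimately show "b \<in> coboundaries i +>\<^bsub>E i\<^esub> z" unfolding a_r_coset_def r_coset_def by force
    qed
  qed
qed

lemma hpart_local_cohomology_nonzero_iff:
  assumes M: "M = local_cohomology cring_class_ops I E d i"
  shows "hpart M n \<noteq> {\<zero>\<^bsub>M\<^esub>} \<longleftrightarrow> (\<exists>z \<in> cocycles i \<inter> hpart (E i) n. z \<notin> coboundaries i)"
proof -
  have hp: "hpart M n = (\<lambda>z. coboundaries i +>\<^bsub>E i\<^esub> z) ` (cocycles i \<inter> hpart (E i) n)"
    and z: "\<zero>\<^bsub>M\<^esub> = coboundaries i"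
    by (simp_all add: M local_cohomology_def Let_def)
  have zero: "\<zero>\<^bsub>E i\<^esub> \<in> cocycles i \<inter> hpart (E i) n"
    by (simp add: cocycles_iff zero_torsion d_zero E.hpart_zero)
  have image: "f ` A \<noteq> {c} \<longleftrightarrow> (\<exists>z \<in> A. f z \<noteq> c)" if "a \<in> A" for f :: "'e \<Rightarrow> 'e set" and A a c
    using that by auto
  show ?thesis
    unfolding hp z image[OF zero] using coset_coboundaries_iff[OF cocycles_carrier] by simp
qed

end

section \<open>Partial derivatives on polynomials\<close>

abbreviation total_degree :: "('n::finite \<Rightarrow>\<^sub>0 nat) \<Rightarrow> nat" where
  "total_degree \<alpha> \<equiv> (\<Sum>j\<in>UNIV. Poly_Mapping.lookup \<alpha> j)"

lemma total_degree_add: "total_degree (\<alpha> + \<beta>) = total_degree \<alpha> + total_degree \<beta>"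
  by (simp add: lookup_add sum.distrib)

lemma total_degree_single: "total_degree (Poly_Mapping.single k n) = n"
  by (simp add: lookup_single when_def)

definition homogeneous_part :: "('a::zero, 'n::finite) mpoly \<Rightarrow> int \<Rightarrow> ('a, 'n) mpoly" where
  "homogeneous_part p n = Abs_poly_mapping (\<lambda>\<alpha>. if int (total_degree \<alpha>) = n then Poly_Mapping.lookup p \<alpha> else 0)"

lemma lookup_homogeneous_part:
  "Poly_Mapping.lookup (homogeneous_part p n) \<alpha> = (if int (total_degree \<alpha>) = n then Poly_Mapping.lookup p \<alpha> else 0)"
proof -
  have "finite {\<alpha>. (if int (total_degree \<alpha>) = n then Poly_Mapping.lookup p \<alpha> else 0) \<noteq> 0}"
    by (rule finite_subset[OF _ finite_lookup[of p]]) auto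
  then show ?thesis by (simp add: homogeneous_part_def)
qed

lemma std_part_iff: "p \<in> std_part n \<longleftrightarrow> (\<forall>\<alpha>. Poly_Mapping.lookup p \<alpha> \<noteq> 0 \<longrightarrow> int (total_degree \<alpha>) = n)"
  by (auto simp: std_part_def in_keys_iff)

lemma graded_comm_ring_std_part:
  "graded_comm_ring (std_part :: int \<Rightarrow> ('a::comm_ring_1, 'n::finite) mpoly set) homogeneous_part"
proof
  show "1 \<in> (std_part 0 :: ('a, 'n) mpoly set)" by (auto simp: std_part_def)
  show "0 \<in> (std_part a :: ('a, 'n) mpoly set)" for a by (simp add: std_part_def)
next
  fix r s :: "('a, 'n) mpoly" and a b :: int
  show "- r \<in> std_part a" if "r \<in> std_part a" using that by (simp add: std_part_iff)
  show "r + s \<in> std_part a" if "r \<in> std_part a" "s \<in> std_part a"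
    using that Poly_Mapping.keys_add[of r s] unfolding std_part_def by blast
  show "r * s \<in> std_part (a + b)" if "r \<in> std_part a" "s \<in> std_part b"
    unfolding std_part_def
  proof (intro CollectI ballI)
    fix \<gamma> assume "\<gamma> \<in> Poly_Mapping.keys (r * s)"
    then obtain \<alpha> \<beta> where "\<gamma> = \<alpha> + \<beta>" "\<alpha> \<in> Poly_Mapping.keys r" "\<beta> \<in> Poly_Mapping.keys s"
      using keys_mult[of r s] by blast
    moreover from this have "int (total_degree \<alpha>) = a" "int (total_degree \<beta>) = b"
      using that by (simp_all add: std_part_def)
    ultimately show "int (total_degree \<gamma>) = a + b" by (simp only: total_degree_add of_nat_add)
  qed
  show "homogeneous_part r a \<in> std_part a" by (simp add: std_part_iff lookup_homogeneous_part)
  show "homogeneous_part (r + s) a = homogeneous_part r a + homogeneous_part s a"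
    by (rule poly_mapping_eqI) (simp add: lookup_homogeneous_part lookup_add)
  show "homogeneous_part r b = (if b = a then r else 0)" if "r \<in> std_part a"
    using that by (intro poly_mapping_eqI) (auto simp: lookup_homogeneous_part std_part_iff)
  have sub: "{n. homogeneous_part r n \<noteq> 0} \<subseteq> (\<lambda>\<alpha>. int (total_degree \<alpha>)) ` Poly_Mapping.keys r"
  proof
    fix n assume "n \<in> {n. homogeneous_part r n \<noteq> 0}"
    then obtain \<alpha> where "Poly_Mapping.lookup (homogeneous_part r n) \<alpha> \<noteq> 0"
      by (metis (mono_tags) lookup_zero mem_Collect_eq poly_mapping_eqI)
    then show "n \<in> (\<lambda>\<alpha>. int (total_degree \<alpha>)) ` Poly_Mapping.keys r"
      by (auto simp: lookup_homogeneous_part in_keys_iff split: if_splits)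
  qed
  then show fin: "finite {n. homogeneous_part r n \<noteq> 0}" by (rule finite_subset) simp
  show "(\<Sum>n | homogeneous_part r n \<noteq> 0. homogeneous_part r n) = r"
  proof (rule poly_mapping_eqI)
    fix \<alpha>
    have "Poly_Mapping.lookup (\<Sum>n | homogeneous_part r n \<noteq> 0. homogeneous_part r n) \<alpha>
        = (\<Sum>n | homogeneous_part r n \<noteq> 0. if int (total_degree \<alpha>) = n then Poly_Mapping.lookup r \<alpha> else 0)"
      by (simp only: lookup_sum lookup_homogeneous_part)
    also have "\<dots> = (if homogeneous_part r (int (total_degree \<alpha>)) \<noteq> 0 then Poly_Mapping.lookup r \<alpha> else 0)"
      using fin by (simp only: sum.delta' mem_Collect_eq)
    also have "\<dots> = Poly_Mapping.lookup r \<alpha>"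
      using lookup_homogeneous_part[of r "int (total_degree \<alpha>)" \<alpha>] by auto
    finally show "Poly_Mapping.lookup (\<Sum>n | homogeneous_part r n \<noteq> 0. homogeneous_part r n) \<alpha> = Poly_Mapping.lookup r \<alpha>" .
  qed
qed

lemma poly_mapping_additive_induct [case_names single add]:
  fixes p :: "'b \<Rightarrow>\<^sub>0 'a::comm_monoid_add"
  assumes single: "\<And>\<beta> b. P (Poly_Mapping.single \<beta> b)" and add: "\<And>p q. P p \<Longrightarrow> P q \<Longrightarrow> P (p + q)"
  shows "P p"
proof -
  have "P (\<Sum>\<beta>\<in>F. Poly_Mapping.single \<beta> (Poly_Mapping.lookup p \<beta>))" if "finite F" for F
    using that single[of _ 0] by induction (auto intro: single add)
  moreover have "(\<Sum>\<beta>\<in>Poly_Mapping.keys p. Poly_Mapping.single \<beta> (Poly_Mapping.lookup p \<beta>)) = p"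
    by (rule poly_mapping_eqI) (simp add: lookup_sum lookup_single when_def in_keys_iff)
  ultimately show ?thesis by (metis finite_keys)
qed

definition variable :: "'n \<Rightarrow> ('a::comm_ring_1, 'n::finite) mpoly" where
  "variable k = Poly_Mapping.single (Poly_Mapping.single k 1) 1"

text \<open>
  The coefficient at \<open>\<alpha>\<close> comes from the monomial whose exponent of the variable is one larger; the
  factor \<open>\<alpha> k + 1\<close> is that exponent.
\<close>

definition partial_deriv :: "'n \<Rightarrow> ('a::comm_ring_1, 'n::finite) mpoly \<Rightarrow> ('a, 'n) mpoly" where
  "partial_deriv k p = Abs_poly_mapping
     (\<lambda>\<alpha>. of_nat (Suc (Poly_Mapping.lookup \<alpha> k)) * Poly_Mapping.lookup p (\<alpha> + Poly_Mapping.single k 1))"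

lemma lookup_partial_deriv:
  "Poly_Mapping.lookup (partial_deriv k p) \<alpha> =
     of_nat (Suc (Poly_Mapping.lookup \<alpha> k)) * Poly_Mapping.lookup p (\<alpha> + Poly_Mapping.single k 1)"
proof -
  let ?f = "\<lambda>\<alpha>. of_nat (Suc (Poly_Mapping.lookup \<alpha> k)) * Poly_Mapping.lookup p (\<alpha> + Poly_Mapping.single k 1)"
  have "finite ((\<lambda>\<alpha>. \<alpha> + Poly_Mapping.single k 1) -` Poly_Mapping.keys p)"
    by (rule finite_vimageI) (auto simp: inj_def)
  moreover have "{\<alpha>. ?f \<alpha> \<noteq> 0} \<subseteq> (\<lambda>\<alpha>. \<alpha> + Poly_Mapping.single k 1) -` Poly_Mapping.keys p"
    by (auto simp: in_keys_iff)
  ultimately have "finite {\<alpha>. ?f \<alpha> \<noteq> 0}" by (rule rev_finite_subset)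
  then show ?thesis unfolding partial_deriv_def by (rule lookup_Abs_poly_mapping[THEN fun_cong])
qed

lemma partial_deriv_add: "partial_deriv k (p + q) = partial_deriv k p + partial_deriv k q"
  by (rule poly_mapping_eqI) (simp add: lookup_partial_deriv lookup_add algebra_simps)

lemma sub_add_single:
  fixes \<beta> :: "'n \<Rightarrow>\<^sub>0 nat"
  assumes "Poly_Mapping.lookup \<beta> k \<noteq> 0"
  shows "\<beta> - Poly_Mapping.single k 1 + Poly_Mapping.single k 1 = \<beta>"
  using assms by (intro poly_mapping_eqI) (auto simp: lookup_add lookup_minus lookup_single when_def)

text \<open>
  If \<open>\<beta> k = 0\<close>, the truncated subtraction in the exponent is harmless because the coefficient is \<open>0\<close>.
\<close>

lemma partial_deriv_single:
  "partial_deriv k (Poly_Mapping.single \<beta> b) =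
     Poly_Mapping.single (\<beta> - Poly_Mapping.single k 1) (of_nat (Poly_Mapping.lookup \<beta> k) * b)"
proof (rule poly_mapping_eqI)
  fix \<alpha>
  let ?e = "Poly_Mapping.single k (1::nat)"
  show "Poly_Mapping.lookup (partial_deriv k (Poly_Mapping.single \<beta> b)) \<alpha> =
     Poly_Mapping.lookup (Poly_Mapping.single (\<beta> - ?e) (of_nat (Poly_Mapping.lookup \<beta> k) * b)) \<alpha>"
  proof (cases "\<beta> = \<alpha> + ?e")
    case True
    then show ?thesis by (simp add: lookup_partial_deriv lookup_add)
  next
    case False
    then have "Poly_Mapping.lookup \<beta> k = 0" if "\<beta> - ?e = \<alpha>" using that sub_add_single[of \<beta> k] by auto
    then show ?thesis using False by (auto simp: lookup_partial_deriv lookup_single when_def)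
  qed
qed

lemma partial_deriv_mult:
  fixes p q :: "('a::comm_ring_1, 'n::finite) mpoly"
  shows "partial_deriv k (p * q) = p * partial_deriv k q + q * partial_deriv k p"
proof (induction p rule: poly_mapping_additive_induct)
  case (single \<alpha> a)
  show ?case
  proof (induction q rule: poly_mapping_additive_induct)
    case (single \<beta> b)
    let ?e = "Poly_Mapping.single k (1::nat)"
    have shift: "Poly_Mapping.single (\<alpha> + (\<beta> - ?e)) (of_nat (Poly_Mapping.lookup \<beta> k) * c) =
        Poly_Mapping.single (\<alpha> + \<beta> - ?e) (of_nat (Poly_Mapping.lookup \<beta> k) * c)" for \<alpha> \<beta> and c :: 'a
    proof (cases "Poly_Mapping.lookup \<beta> k = 0")
      case False
      have "\<alpha> + (\<beta> - ?e) = \<alpha> + \<beta> - ?e"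
        by (metis sub_add_single[OF False] add.assoc add_diff_cancel_right')
      then show ?thesis by simp
    qed simp
    show ?case
      using shift[of \<alpha> \<beta> "a * b"] shift[of \<beta> \<alpha> "a * b"]
      by (simp add: mult_single partial_deriv_single lookup_add algebra_simps single_add[symmetric])
  next
    case (add p q)
    then show ?case by (simp add: partial_deriv_add algebra_simps)
  qed
next
  case (add p q)
  then show ?case by (simp add: partial_deriv_add algebra_simps)
qed

lemma variable_std_part: "variable k \<in> std_part 1"
  by (simp add: std_part_def variable_def total_degree_single del: One_nat_def of_nat_sum)

lemma partial_deriv_variable: "partial_deriv k (variable k) = 1"
  by (simp add: variable_def partial_deriv_single)

lemma derivation_partial_deriv:
  "graded_comm_ring.derivation std_part (-1)
     (partial_deriv k :: ('a::comm_ring_1, 'n::finite) mpoly \<Rightarrow> ('a, 'n) mpoly)"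
proof -
  have "partial_deriv k r \<in> std_part (a + -1)" if "r \<in> std_part a" for r :: "('a, 'n) mpoly" and a
    unfolding std_part_iff
  proof (intro allI impI)
    fix \<alpha> assume "Poly_Mapping.lookup (partial_deriv k r) \<alpha> \<noteq> 0"
    then have "Poly_Mapping.lookup r (\<alpha> + Poly_Mapping.single k 1) \<noteq> 0" by (auto simp: lookup_partial_deriv)
    then have "int (total_degree (\<alpha> + Poly_Mapping.single k 1)) = a" using that by (simp add: std_part_iff)
    then show "int (total_degree \<alpha>) = a + -1" by (simp add: total_degree_add total_degree_single del: One_nat_def of_nat_sum)
  qed
  then show ?thesis
    unfolding graded_comm_ring.derivation_def[OF graded_comm_ring_std_part]
    by (simp add: partial_deriv_add partial_deriv_mult)
qed

text \<open>
  Euler's identity, coefficient by coefficient: the Euler operator multiplies each monomial by its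
  degree.
\<close>

lemma lookup_euler:
  "Poly_Mapping.lookup (\<Sum>k\<in>UNIV. variable k * partial_deriv k p) \<alpha> = of_nat (total_degree \<alpha>) * Poly_Mapping.lookup p \<alpha>"
proof (induction p rule: poly_mapping_additive_induct)
  case (single \<beta> b)
  have "variable k * partial_deriv k (Poly_Mapping.single \<beta> b) = Poly_Mapping.single \<beta> (of_nat (Poly_Mapping.lookup \<beta> k) * b)" for k
  proof (cases "Poly_Mapping.lookup \<beta> k = 0")
    case False
    then show ?thesis
      using sub_add_single[OF False] by (simp add: variable_def partial_deriv_single mult_single add.commute)
  qed (simp add: variable_def partial_deriv_single)
  then show ?case
    by (simp add: lookup_sum lookup_single when_def sum_distrib_right)
next
  case (add p q)
  then show ?case by (simp add: partial_deriv_add algebra_simps sum.distrib lookup_add)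
qed

lemma lookup_of_int_mult: "Poly_Mapping.lookup (of_int n * p) \<alpha> = of_int n * Poly_Mapping.lookup p \<alpha>"
  for p :: "('a::comm_ring_1, 'n::finite) mpoly"
proof -
  have "Poly_Mapping.lookup (of_nat m * p) \<alpha> = of_nat m * Poly_Mapping.lookup p \<alpha>" for m
    by (induction m) (simp_all add: algebra_simps lookup_add)
  then show ?thesis by (cases n rule: int_cases2) simp_all
qed

lemma euler_partial_deriv:
  assumes "r \<in> std_part a"
  shows "(\<Sum>k\<in>UNIV. variable k * partial_deriv k r) = of_int a * r"
proof (rule poly_mapping_eqI)
  fix \<alpha>
  have "of_nat (total_degree \<alpha>) * Poly_Mapping.lookup r \<alpha> = of_int a * Poly_Mapping.lookup r \<alpha>"
    using assms by (cases "Poly_Mapping.lookup r \<alpha> = 0") (auto simp: std_part_iff simp del: of_nat_sum)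
  then show "Poly_Mapping.lookup (\<Sum>k\<in>UNIV. variable k * partial_deriv k r) \<alpha> = Poly_Mapping.lookup (of_int a * r) \<alpha>"
    by (simp only: lookup_euler lookup_of_int_mult)
qed

lemma subfield_inverse_of_int:
  fixes K :: "'a::comm_ring_1 set"
  assumes K: "subfield K (cring_class_ops :: 'a ring)"
    and char_zero: "\<forall>k::nat. k > 0 \<longrightarrow> (of_nat k :: 'a) \<noteq> 0" and n: "n \<noteq> 0"
  shows "\<exists>u::'a. u * of_int n = 1"
proof -
  interpret subfield K "cring_class_ops :: 'a ring" by (rule K)
  have sub: "subring K (cring_class_ops :: 'a ring)" by (rule subring_axioms)
  have "of_nat k \<in> K" for k
    using subringE(2,3)[OF sub] subringE(7)[OF sub] by (induction k) (auto simp: class_simps)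
  moreover obtain N where N: "N > 0" "n = int N \<or> n = - int N"
    by (rule that[of "nat \<bar>n\<bar>"]) (use n in auto)
  ultimately have "of_nat N \<in> K - {\<zero>\<^bsub>cring_class_ops :: 'a ring\<^esub>}"
    using char_zero by (simp add: class_simps)
  from ring.subfield_m_inv(3)[OF ring_class K this] obtain u :: 'a where "u * of_nat N = 1"
    by (metis one_class times_class)
  then have "u * of_int n = 1 \<or> (- u) * of_int n = 1" using N(2) by auto
  then show ?thesis by blast
qed

lemma mpoly_inverse_of_int:
  fixes u :: "'a::comm_ring_1"
  assumes "u * of_int n = 1"
  shows "Poly_Mapping.single 0 u * of_int n = (1 :: ('a, 'n::finite) mpoly)"
proof -
  have "of_int n = Poly_Mapping.single (0 :: 'n \<Rightarrow>\<^sub>0 nat) (of_int n :: 'a)" by simp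
  then show ?thesis using assms by (simp only: mult_single) simp
qed

section \<open>Nonvanishing of the graded components\<close>

theorem theorem1p4:
  fixes K :: "'a::comm_ring_1 set"
    and R :: "('a, 'n::finite) mpoly ring"
    and I :: "('a, 'n) mpoly set"
    and E :: "nat \<Rightarrow> (('a, 'n) mpoly, 'e) gmodule"
    and \<epsilon> :: "('a, 'n) mpoly \<Rightarrow> 'e"
    and d :: "nat \<Rightarrow> 'e \<Rightarrow> 'e"
    and i :: nat
    and M :: "(('a, 'n) mpoly, 'e set) gmodule"
    and m :: int
  assumes noetherian: "noetherian_ring (cring_class_ops :: 'a ring)"
    and subfield: "subfield K (cring_class_ops :: 'a ring)"
    and char_zero: "\<forall>k::nat. k > 0 \<longrightarrow> (of_nat k :: 'a) \<noteq> 0"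
    and m: "m = int CARD('n)"
    and R: "R = cring_class_ops"
    and I: "homogeneous_ideal R std_part I"
    and resolution: "graded_injective_resolution R std_part (self_gmodule R std_part) E \<epsilon> d"
    and M: "M = local_cohomology R I E d i"
  shows "((\<exists>r. r \<le> - m \<and> hpart M r \<noteq> {\<zero>\<^bsub>M\<^esub>}) \<longleftrightarrow> (\<forall>n. n \<le> - m \<longrightarrow> hpart M n \<noteq> {\<zero>\<^bsub>M\<^esub>}))
       \<and> ((\<exists>s. s \<ge> 0 \<and> hpart M s \<noteq> {\<zero>\<^bsub>M\<^esub>}) \<longleftrightarrow> (\<forall>n. n \<ge> 0 \<longrightarrow> hpart M n \<noteq> {\<zero>\<^bsub>M\<^esub>}))
       \<and> (m \<ge> 2 \<longrightarrow>
           ((\<exists>t. - m < t \<and> t < 0 \<and> hpart M t \<noteq> {\<zero>\<^bsub>M\<^esub>}) \<longleftrightarrow> (\<forall>n. hpart M n \<noteq> {\<zero>\<^bsub>M\<^esub>})))"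
proof -
  interpret graded_comm_ring "std_part :: int \<Rightarrow> ('a, 'n) mpoly set" homogeneous_part
    by (rule graded_comm_ring_std_part)
  interpret L: local_cohomology_resolution "std_part :: int \<Rightarrow> ('a, 'n) mpoly set" homogeneous_part E \<epsilon> d I
    using resolution I
    by (intro local_cohomology_resolution.intro graded_resolution.intro graded_comm_ring_std_part
        graded_resolution_axioms.intro local_cohomology_resolution_axioms.intro)
      (simp_all add: R homogeneous_ideal_def)
  define nz where "nz n \<longleftrightarrow> hpart M n \<noteq> {\<zero>\<^bsub>M\<^esub>}" for n
  have nz_iff: "nz n \<longleftrightarrow> (\<exists>z \<in> L.cocycles i \<inter> hpart (E i) n. z \<notin> L.coboundaries i)" for n
    unfolding nz_def by (rule L.hpart_local_cohomology_nonzero_iff) (simp add: M R)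
  have unit: "\<exists>u. u * of_int n = (1 :: ('a, 'n) mpoly)" if "n \<noteq> 0" for n
    using subfield_inverse_of_int[OF subfield char_zero that] mpoly_inverse_of_int by blast
  have D: "derivation (-1) (partial_deriv k :: ('a, 'n) mpoly \<Rightarrow> _)" for k
    by (rule derivation_partial_deriv)
  have up: "nz (n + 1)" if "nz n" "n \<noteq> - m" for n
    using L.degree_step_up[OF variable_std_part D partial_deriv_variable euler_partial_deriv unit] that
    unfolding nz_iff m by blast
  have down: "nz (n - 1)" if "nz n" "n \<noteq> 0" for n
    using L.degree_step_down[OF variable_std_part D partial_deriv_variable euler_partial_deriv unit] that
    unfolding nz_iff by blast
  have m1: "m \<ge> 1" by (simp add: m Suc_le_eq)
  \<comment> \<open>Steps upwards fail only from degree \<open>- m\<close>, steps downwards only from degree \<open>0\<close>.\<close>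
  have ascend: "nz n" if "nz r" "r \<le> n" "n \<le> - m \<or> - m < r" for r n
    using that(2,1,3) by (induction rule: int_ge_induct) (auto intro: up)
  have descend: "nz n" if "nz r" "n \<le> r" "0 \<le> n \<or> r < 0" for r n
    using that(2,1,3) by (induction rule: int_le_induct) (auto intro: down)
  have a: "(\<exists>r. r \<le> - m \<and> nz r) \<longleftrightarrow> (\<forall>n. n \<le> - m \<longrightarrow> nz n)"
    using ascend descend m1 by (smt (verit))
  have b: "(\<exists>s. s \<ge> 0 \<and> nz s) \<longleftrightarrow> (\<forall>n. n \<ge> 0 \<longrightarrow> nz n)"
    using ascend descend m1 by (smt (verit))
  have c: "(\<exists>t. - m < t \<and> t < 0 \<and> nz t) \<longleftrightarrow> (\<forall>n. nz n)" if "m \<ge> 2"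
  proof
    assume "\<forall>n. nz n"
    then show "\<exists>t. - m < t \<and> t < 0 \<and> nz t" using that by (intro exI[of _ "-1"]) auto
  qed (use ascend descend in \<open>meson linear\<close>)
  show ?thesis using a b c unfolding nz_def by blast
qed

end
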